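(* Let $\alpha\in(0,1)$ and let $q(x,t)=Lg+Ag+p(x,t)\in L_2(Q_T)$. Then there exists a unique minimizer $v_{\min}\in H_0^2(Q_T)$, over the space $H_0^2(Q_T)$, of the functional $$J_\alpha(v)=\int_{Q_T}(v_t-Lv-Av-q)^2\,dx\,dt+\alpha\|v\|_{H^2(Q_T)}^2 .$$
   Context: All functions are real valued. $\Omega\subset\mathbb{R}^n$ is a bounded domain with piecewise smooth boundary $\partial\Omega$, $T>0$, $Q_T=\Omega\times(0,T)$, $S_T=\partial\Omega\times(0,T)$. The functions $a_{ij}$, $i,j=1,\dots,n$, satisfy $a_{ij}=a_{ji}\in C^1(\overline{Q}_T)$ and, for constants $0<\mu_1\le\mu_2$, $\mu_1|\xi|^2\le\sum_{i,j=1}^n a_{ij}(x,t)\xi_i\xi_j\le\mu_2|\xi|^2$ for all $(x,t)\in\overline{Q}_T$, $\xi\in\mathbb{R}^n$. The operators are $Lu=\sum_{i,j=1}^n a_{ij}(x,t)u_{x_ix_j}$ and $Au=\sum_{j=1}^n b_j(x,t)u_{x_j}+c(x,t)u$, where $b_j,c,p\in C(\overline{Q}_T)$. The function $g\in H^2(\Omega)$ satisfies $g(x)=0$ for $x\in\partial\Omega$. $H^2(Q_T)$ is the Sobolev space over the $(n+1)$-dimensional domain $Q_T$, and $H_0^2(Q_T)=\{w\in H^2(Q_T): w|_{S_T}=0,\ w(x,T)=0\}$ (traces). *)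

theory Defs
  imports "HOL-Analysis.Analysis" "HOL-Library.Multiset"
begin

section \<open>Classical differentiability\<close>

definition dir_deriv :: "'a::euclidean_space \<Rightarrow> ('a \<Rightarrow> real) \<Rightarrow> 'a \<Rightarrow> real" where
  "dir_deriv b f x = frechet_derivative f (at x) b"

text \<open>Only meaningful for open \<open>S\<close>, since derivatives are taken at points of the full space.\<close>

fun Ck_on :: "nat \<Rightarrow> 'a::euclidean_space set \<Rightarrow> ('a \<Rightarrow> real) \<Rightarrow> bool" where
  "Ck_on 0 S f \<longleftrightarrow> continuous_on S f"
| "Ck_on (Suc k) S f \<longleftrightarrow>
     (\<forall>x\<in>S. f differentiable (at x)) \<and> (\<forall>b\<in>Basis. Ck_on k S (dir_deriv b f))"

text \<open>\<open>C\<^sup>1\<close> up to the boundary: \<open>f\<close> and its gradient on the open set \<open>Q\<close> extend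
  continuously to the closure.\<close>

definition C1_closure :: "'a::euclidean_space set \<Rightarrow> ('a \<Rightarrow> real) set" where
  "C1_closure Q = {f. continuous_on (closure Q) f \<and>
     (\<exists>G. continuous_on (closure Q) G \<and>
        (\<forall>x\<in>Q. (f has_derivative (\<lambda>h. G x \<bullet> h)) (at x)))}"

definition test_function :: "'a::euclidean_space set \<Rightarrow> ('a \<Rightarrow> real) \<Rightarrow> bool" where
  "test_function Q \<phi> \<longleftrightarrow> (\<forall>k. Ck_on k UNIV \<phi>) \<and>
     compact (closure {x. \<phi> x \<noteq> 0}) \<and> closure {x. \<phi> x \<noteq> 0} \<subseteq> Q"

section \<open>Sobolev spaces\<close>

text \<open>Elements of \<open>L\<^sub>2\<close> and of the Sobolev spaces are represented by functions;
  equality in these spaces is equality almost everywhere.\<close>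

definition L2 :: "'a measure \<Rightarrow> ('a \<Rightarrow> real) set" where
  "L2 M = {f. f \<in> borel_measurable M \<and> integrable M (\<lambda>x. (f x)\<^sup>2)}"

text \<open>A multi-index is a multiset of standard basis vectors: \<open>{#b, c#}\<close> stands for
  differentiating once in direction \<open>b\<close> and once in direction \<open>c\<close>. In this way each mixed
  derivative occurs exactly once in sums over all multi-indices. The order in which
  a test function is differentiated is irrelevant, so all listings of \<open>\<beta>\<close> are allowed.\<close>

definition has_weak_deriv ::
    "'a::euclidean_space set \<Rightarrow> 'a multiset \<Rightarrow> ('a \<Rightarrow> real) \<Rightarrow> ('a \<Rightarrow> real) \<Rightarrow> bool" where
  "has_weak_deriv Q \<beta> u w \<longleftrightarrow> u \<in> L2 (lebesgue_on Q) \<and> w \<in> L2 (lebesgue_on Q) \<and>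
     (\<forall>\<phi> bs. test_function Q \<phi> \<and> mset bs = \<beta> \<longrightarrow>
        (LINT x|lebesgue_on Q. u x * foldr dir_deriv bs \<phi> x) =
        (- 1) ^ size \<beta> * (LINT x|lebesgue_on Q. w x * \<phi> x))"

definition multi_indices :: "nat \<Rightarrow> 'a::euclidean_space multiset set" where
  "multi_indices k = {\<beta>. set_mset \<beta> \<subseteq> Basis \<and> size \<beta> \<le> k}"

definition sobolev :: "nat \<Rightarrow> 'a::euclidean_space set \<Rightarrow> ('a \<Rightarrow> real) set" where
  "sobolev k Q = {u. \<forall>\<beta>\<in>multi_indices k. \<exists>w. has_weak_deriv Q \<beta> u w}"

text \<open>The weak derivative (in \<open>L\<^sub>2\<close>), which is unique up to null sets if it exists.\<close>

definition weak_deriv ::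
    "'a::euclidean_space set \<Rightarrow> 'a multiset \<Rightarrow> ('a \<Rightarrow> real) \<Rightarrow> 'a \<Rightarrow> real" where
  "weak_deriv Q \<beta> u = (SOME w. has_weak_deriv Q \<beta> u w)"

definition sobolev_norm :: "nat \<Rightarrow> 'a::euclidean_space set \<Rightarrow> ('a \<Rightarrow> real) \<Rightarrow> real" where
  "sobolev_norm k Q u =
     sqrt (\<Sum>\<beta>\<in>multi_indices k. LINT x|lebesgue_on Q. (weak_deriv Q \<beta> u x)\<^sup>2)"

section \<open>Surface measure and traces\<close>

text \<open>Boundedness is required because \<open>diameter\<close> is \<open>0\<close> on unbounded sets; empty covering
  sets are counted as \<open>0\<close> so that dimension \<open>0\<close> gives the counting measure. The leading
  factor makes the measure agree with surface area on hypersurfaces.\<close>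

definition hausdorff_outer :: "nat \<Rightarrow> 'a::euclidean_space set \<Rightarrow> ennreal" where
  "hausdorff_outer d A = ennreal (unit_ball_vol (real d) / 2 ^ d) *
     (SUP \<delta>\<in>{0<..}.
        INF C\<in>{C :: nat \<Rightarrow> 'a set.
                A \<subseteq> (\<Union>k. C k) \<and> (\<forall>k. bounded (C k) \<and> diameter (C k) \<le> \<delta>)}.
          \<Sum>k. if C k = {} then 0 else ennreal (diameter (C k) ^ d))"

definition surface_measure :: "'a::euclidean_space measure" where
  "surface_measure = measure_of UNIV (sets borel) (hausdorff_outer (DIM('a) - 1))"

text \<open>The trace on a part \<open>\<Gamma>\<close> of the boundary of \<open>Q\<close> is the extension by continuity, from
  \<open>H\<^sup>1(Q)\<close> to \<open>L\<^sub>2(\<Gamma>)\<close>, of the restriction map on functions that are \<open>C\<^sup>1\<close> up to the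
  boundary.\<close>

definition has_trace ::
    "'a::euclidean_space set \<Rightarrow> 'a set \<Rightarrow> ('a \<Rightarrow> real) \<Rightarrow> ('a \<Rightarrow> real) \<Rightarrow> bool" where
  "has_trace Q \<Gamma> u f \<longleftrightarrow>
     u \<in> sobolev 1 Q \<and> f \<in> L2 (restrict_space surface_measure \<Gamma>) \<and>
     (\<exists>U :: nat \<Rightarrow> 'a \<Rightarrow> real.
        (\<forall>k. U k \<in> C1_closure Q \<inter> sobolev 1 Q) \<and>
        (\<lambda>k. sobolev_norm 1 Q (\<lambda>x. U k x - u x)) \<longlonglongrightarrow> 0 \<and>
        (\<lambda>k. \<integral>\<^sup>+x. ennreal ((U k x - f x)\<^sup>2) \<partial>restrict_space surface_measure \<Gamma>) \<longlonglongrightarrow> 0)"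

section \<open>Domains\<close>

definition bounded_domain :: "'a::euclidean_space set \<Rightarrow> bool" where
  "bounded_domain \<Omega> \<longleftrightarrow> open \<Omega> \<and> connected \<Omega> \<and> bounded \<Omega> \<and> \<Omega> \<noteq> {}"

text \<open>The boundary consists of finitely many compact pieces \<open>F\<close> of regular hypersurfaces
  \<open>\<phi> = 0\<close>, and except for a set of surface measure zero (edges and corners) the set \<open>\<Omega>\<close>
  lies locally on one side of one of them. Smoothness of the pieces is only required in
  the weakest sense \<open>C\<^sup>1\<close>.\<close>

definition piecewise_smooth_boundary :: "'a::euclidean_space set \<Rightarrow> bool" where
  "piecewise_smooth_boundary \<Omega> \<longleftrightarrow>
     (\<exists>P :: ('a set \<times> 'a set \<times> ('a \<Rightarrow> real)) set. finite P \<and>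
        frontier \<Omega> = (\<Union>(F, U, \<phi>)\<in>P. F) \<and>
        (\<forall>(F, U, \<phi>)\<in>P. compact F \<and> open U \<and> Ck_on 1 U \<phi> \<and> F \<subseteq> {x\<in>U. \<phi> x = 0} \<and>
           (\<forall>x\<in>U. \<exists>b\<in>Basis. dir_deriv b \<phi> x \<noteq> 0)) \<and>
        hausdorff_outer (DIM('a) - 1)
          {x \<in> frontier \<Omega>. \<not> (\<exists>(F, U, \<phi>)\<in>P. \<exists>r>0. x \<in> F \<and> ball x r \<subseteq> U \<and>
             \<Omega> \<inter> ball x r = {y \<in> ball x r. \<phi> y < 0})} = 0)"

section \<open>The parabolic problem\<close>

definition cylinder :: "(real^'n) set \<Rightarrow> real \<Rightarrow> ((real^'n) \<times> real) set" where
  "cylinder \<Omega> T = \<Omega> \<times> {0<..<T}"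

definition H20 :: "(real^'n) set \<Rightarrow> real \<Rightarrow> ((real^'n) \<times> real \<Rightarrow> real) set" where
  "H20 \<Omega> T = {w \<in> sobolev 2 (cylinder \<Omega> T).
     has_trace (cylinder \<Omega> T) (frontier \<Omega> \<times> {0<..<T}) w (\<lambda>_. 0) \<and>
     has_trace (cylinder \<Omega> T) (\<Omega> \<times> {T}) w (\<lambda>_. 0)}"

abbreviation ex :: "'n::finite \<Rightarrow> (real^'n) \<times> real" where
  "ex i \<equiv> (axis i 1, 0)"

abbreviation et :: "(real^'n) \<times> real" where
  "et \<equiv> (0, 1)"

text \<open>\<open>L\<close> and \<open>A\<close> are written in terms of the function \<open>u\<close>, its spatial gradient \<open>D\<close> and its
  spatial Hessian \<open>H\<close>, all as functions of \<open>(x, t)\<close>, since they are applied both to functions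
  on the cylinder and to functions of \<open>x\<close> alone.\<close>

definition op_L ::
    "('n \<Rightarrow> 'n \<Rightarrow> 'z \<Rightarrow> real) \<Rightarrow> ('n::finite \<Rightarrow> 'n \<Rightarrow> 'z \<Rightarrow> real) \<Rightarrow> 'z \<Rightarrow> real" where
  "op_L a H z = (\<Sum>i\<in>UNIV. \<Sum>j\<in>UNIV. a i j z * H i j z)"

definition op_A ::
    "('n \<Rightarrow> 'z \<Rightarrow> real) \<Rightarrow> ('z \<Rightarrow> real) \<Rightarrow> ('n::finite \<Rightarrow> 'z \<Rightarrow> real) \<Rightarrow> ('z \<Rightarrow> real) \<Rightarrow> 'z \<Rightarrow> real" where
  "op_A b c D u z = (\<Sum>j\<in>UNIV. b j z * D j z) + c z * u z"

text \<open>\<open>L\<close> and \<open>A\<close> on functions \<open>v(x, t)\<close> on a set \<open>Q\<close>:\<close>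

definition L_cyl where
  "L_cyl Q a v = op_L a (\<lambda>i j. weak_deriv Q {#ex i, ex j#} v)"

definition A_cyl where
  "A_cyl Q b c v = op_A b c (\<lambda>j. weak_deriv Q {#ex j#} v) v"

text \<open>The same on functions \<open>g(x)\<close> on \<open>\<Omega>\<close>; the results still depend on \<open>t\<close> through the
  coefficients.\<close>

definition L_dom ::
    "(real^'n) set \<Rightarrow> ('n \<Rightarrow> 'n \<Rightarrow> (real^'n) \<times> real \<Rightarrow> real) \<Rightarrow> (real^'n \<Rightarrow> real) \<Rightarrow>
     (real^'n) \<times> real \<Rightarrow> real" where
  "L_dom \<Omega> a g = op_L a (\<lambda>i j (x, t). weak_deriv \<Omega> {#axis i 1, axis j 1#} g x)"

definition A_dom ::
    "(real^'n) set \<Rightarrow> ('n \<Rightarrow> (real^'n) \<times> real \<Rightarrow> real) \<Rightarrow> ((real^'n) \<times> real \<Rightarrow> real) \<Rightarrow>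
     (real^'n \<Rightarrow> real) \<Rightarrow> (real^'n) \<times> real \<Rightarrow> real" where
  "A_dom \<Omega> b c g = op_A b c (\<lambda>j (x, t). weak_deriv \<Omega> {#axis j 1#} g x) (\<lambda>(x, t). g x)"

definition tikhonov ::
    "((real^'n) \<times> real) set \<Rightarrow> ('n \<Rightarrow> 'n \<Rightarrow> (real^'n) \<times> real \<Rightarrow> real) \<Rightarrow>
     ('n \<Rightarrow> (real^'n) \<times> real \<Rightarrow> real) \<Rightarrow> ((real^'n) \<times> real \<Rightarrow> real) \<Rightarrow> ((real^'n) \<times> real \<Rightarrow> real) \<Rightarrow>
     real \<Rightarrow> ((real^'n) \<times> real \<Rightarrow> real) \<Rightarrow> real" where
  "tikhonov Q a b c q \<alpha> v =
     (LINT z|lebesgue_on Q.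
        (weak_deriv Q {#et#} v z - L_cyl Q a v z - A_cyl Q b c v z - q z)\<^sup>2)
     + \<alpha> * (sobolev_norm 2 Q v)\<^sup>2"

end

theory Submission
  imports Defs
begin

text \<open>The functional is a regularized least squares functional
  \<open>J(v) = \<parallel>K v - q\<parallel>\<^sup>2 + \<alpha> \<parallel>v\<parallel>\<^sup>2\<close>, where \<open>K\<close> is a linear differential operator of second order with
  bounded coefficients and the second norm is that of the Hilbert space \<open>H\<^sup>2(Q)\<close>. The parallelogram
  law for this norm makes \<open>J\<close> uniformly convex:
  \<open>J((u + v) / 2) + \<alpha>/4 \<parallel>u - v\<parallel>\<^sup>2 \<le> (J(u) + J(v)) / 2\<close> (\<open>least_squares_midpoint\<close>).
  If \<open>J(u)\<close> and \<open>J(v)\<close> are close to the infimum, then \<open>u\<close> and \<open>v\<close> are therefore close to each other. So a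
  minimizing sequence is a Cauchy sequence, and two minimizers coincide. The limit of the
  sequence is a minimizer because \<open>H\<^sup>2(Q)\<close> is complete (\<open>sobolev_complete\<close>), the space of
  admissible functions is closed in it (\<open>H20_limit\<close>), and \<open>J\<close> is continuous
  (\<open>least_squares_continuity\<close>). This argument is \<open>least_squares_unique_minimizer\<close>; it is carried
  out for operators of any order and for any nonempty closed midpoint-convex set of admissible functions.

  The norm is built from weak derivatives that are chosen arbitrarily among the functions
  satisfying the defining integral identities, so even the linearity of differentiation rests
  on the uniqueness of weak derivatives up to null sets. This is the fundamental lemma of
  the calculus of variations (\<open>test_function_orthogonal_imp_AE_0\<close>): smooth bump functions
  increase to the indicator functions of boxes, so a function orthogonal to all
  test functions has integral zero over every box in the domain, and differentiation of the integral shows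
  that it vanishes almost everywhere. Completeness of \<open>H\<^sup>2(Q)\<close> follows from that of \<open>L\<^sub>2\<close>, because the
  identities defining weak derivatives survive limits in \<open>L\<^sub>2\<close>.

  Having trace zero means being approximated in \<open>H\<^sup>1\<close> by functions
  that are \<open>C\<^sup>1\<close> up to the boundary and small in \<open>L\<^sub>2\<close> of the boundary part; a diagonal choice of
  approximants shows that this condition is closed.

  That \<open>q\<close> is square integrable reduces to Fubini's theorem: the weak derivatives of \<open>g\<close> depend on
  \<open>x\<close> alone, and all coefficients are bounded on the cylinder (\<open>L2_fst\<close>, \<open>source_L2\<close>).\<close>

section \<open>Test functions and the fundamental lemma of the calculus of variations\<close>

text \<open>The functions obtained by differentiating \<open>exp (- 1 / s)\<close>, extended by zero, are linear
  combinations of these.\<close>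

definition flat_exp :: "nat \<Rightarrow> real \<Rightarrow> real" where
  "flat_exp k s = (if s > 0 then exp (- (1 / s)) / s ^ k else 0)"

lemma flat_exp_tendsto_0: "((\<lambda>s. flat_exp k s) \<longlongrightarrow> 0) (at_right 0)"
proof -
  have "((\<lambda>s. (inverse s) ^ k / exp (inverse s)) \<longlongrightarrow> (0::real)) (at_right 0)"
    by (rule filterlim_compose[OF tendsto_power_div_exp_0 filterlim_inverse_at_top_right])
  moreover have "eventually (\<lambda>s::real. (inverse s) ^ k / exp (inverse s) = flat_exp k s) (at_right 0)"
    by (rule eventually_at_right_less[THEN eventually_mono])
       (simp add: flat_exp_def exp_minus field_simps)
  ultimately show ?thesis by (rule Lim_transform_eventually)
qed

lemma DERIV_flat_exp:
  "(flat_exp k has_real_derivative (flat_exp (k + 2) s - real k * flat_exp (k + 1) s)) (at s)"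
proof -
  consider "s > 0" | "s < 0" | "s = 0" by linarith
  then show ?thesis
  proof cases
    case 1
    have "((\<lambda>s. exp (- (1 / s)) / s ^ k) has_real_derivative
        (flat_exp (k + 2) s - real k * flat_exp (k + 1) s)) (at s)"
      using 1 by (auto intro!: derivative_eq_intros simp: flat_exp_def)
        (cases k; simp add: field_simps power2_eq_square)
    then show ?thesis
      by (rule has_field_derivative_transform_within_open[where S="{0<..}"])
         (use 1 in \<open>auto simp: flat_exp_def\<close>)
  next
    case 2
    have "((\<lambda>s. 0) has_real_derivative 0) (at s)" by simp
    then have "(flat_exp k has_real_derivative 0) (at s)"
      by (rule has_field_derivative_transform_within_open[where S="{..<0}"])
         (use 2 in \<open>auto simp: flat_exp_def\<close>)
    then show ?thesis using 2 by (simp add: flat_exp_def)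
  next
    case 3
    have r: "((\<lambda>h. flat_exp k h / h) \<longlongrightarrow> 0) (at_right 0)"
      using flat_exp_tendsto_0[of "Suc k"]
      by (rule Lim_transform_eventually)
         (rule eventually_at_right_less[THEN eventually_mono], simp add: flat_exp_def field_simps)
    have l: "((\<lambda>h. flat_exp k h / h) \<longlongrightarrow> 0) (at_left 0)"
      by (rule Lim_transform_eventually[OF tendsto_const])
         (simp add: eventually_at_filter flat_exp_def)
    have "((\<lambda>h. flat_exp k h / h) \<longlongrightarrow> 0) (at 0)"
      using l r by (simp add: filterlim_split_at)
    then show ?thesis using 3 by (simp add: DERIV_def flat_exp_def)
  qed
qed

text \<open>An algebra of smooth functions on the line. Defining it as the closure of the flat functions
  under the algebraic operations makes smoothness an induction: differentiation does not lead
  out of it (\<open>cutoffs_closed_deriv\<close>), which gives derivatives of all orders at once.\<close>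

inductive_set cutoffs :: "(real \<Rightarrow> real) set" where
  flat: "(\<lambda>s. flat_exp k (m * s + r)) \<in> cutoffs"
| add: "f \<in> cutoffs \<Longrightarrow> g \<in> cutoffs \<Longrightarrow> (\<lambda>s. f s + g s) \<in> cutoffs"
| mult: "f \<in> cutoffs \<Longrightarrow> g \<in> cutoffs \<Longrightarrow> (\<lambda>s. f s * g s) \<in> cutoffs"
| scale: "f \<in> cutoffs \<Longrightarrow> (\<lambda>s. c * f s) \<in> cutoffs"

lemma cutoffs_closed_deriv:
  assumes "f \<in> cutoffs"
  shows "\<exists>f'\<in>cutoffs. \<forall>s. (f has_real_derivative f' s) (at s)"
  using assms
proof induction
  case (flat k m r)
  let ?d = "\<lambda>s. m * (flat_exp (k + 2) (m * s + r) + (- real k) * flat_exp (k + 1) (m * s + r))"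
  have "?d \<in> cutoffs" by (intro cutoffs.intros)
  moreover have "((\<lambda>s. flat_exp k (m * s + r)) has_real_derivative ?d s) (at s)" for s
    by (rule DERIV_cong[OF DERIV_chain2[OF DERIV_flat_exp]])
       (auto intro!: derivative_eq_intros)
  ultimately show ?case by (intro bexI[of _ ?d]) auto
next
  case (add f g)
  then obtain f' g' where fg: "f' \<in> cutoffs" "\<And>s. (f has_real_derivative f' s) (at s)"
    "g' \<in> cutoffs" "\<And>s. (g has_real_derivative g' s) (at s)" by blast
  show ?case
    by (rule bexI[of _ "\<lambda>s. f' s + g' s"])
       (auto intro!: cutoffs.intros derivative_eq_intros fg)
next
  case (mult f g)
  then obtain f' g' where fg: "f' \<in> cutoffs" "\<And>s. (f has_real_derivative f' s) (at s)"
    "g' \<in> cutoffs" "\<And>s. (g has_real_derivative g' s) (at s)" by blast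
  show ?case
    by (rule bexI[of _ "\<lambda>s. f' s * g s + g' s * f s"])
       (auto intro!: cutoffs.intros derivative_eq_intros fg mult)
next
  case (scale f c)
  then obtain f' where f: "f' \<in> cutoffs" "\<And>s. (f has_real_derivative f' s) (at s)" by blast
  show ?case
    by (rule bexI[of _ "\<lambda>s. c * f' s"])
       (auto intro!: cutoffs.intros derivative_eq_intros f)
qed

text \<open>Products of functions of one coordinate each. A partial derivative changes a single factor,
  so such products stay within the same class under differentiation.\<close>

definition tensor :: "('a::euclidean_space \<Rightarrow> real \<Rightarrow> real) \<Rightarrow> 'a \<Rightarrow> real" where
  "tensor h x = (\<Prod>i\<in>Basis. h i (x \<bullet> i))"

lemma tensor_has_derivative:
  assumes "\<And>i s. i \<in> Basis \<Longrightarrow> (h i has_real_derivative h' i s) (at s)"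
  shows "(tensor h has_derivative
    (\<lambda>y. \<Sum>i\<in>Basis. (h' i (x \<bullet> i) * (y \<bullet> i)) * (\<Prod>j\<in>Basis - {i}. h j (x \<bullet> j)))) (at x)"
  unfolding tensor_def[abs_def]
proof (rule has_derivative_prod)
  fix i :: 'a assume "i \<in> Basis"
  have "(h i has_derivative (\<lambda>y. h' i (x \<bullet> i) * y)) (at (x \<bullet> i))"
    using assms[OF \<open>i \<in> Basis\<close>] by (simp add: has_field_derivative_def)
  moreover have "((\<lambda>x. x \<bullet> i) has_derivative (\<lambda>y. y \<bullet> i)) (at x)"
    by (auto intro!: derivative_eq_intros)
  ultimately show "((\<lambda>x. h i (x \<bullet> i)) has_derivative (\<lambda>y. h' i (x \<bullet> i) * (y \<bullet> i))) (at x)"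
    by (rule has_derivative_compose[rotated])
qed

lemma tensor_cutoffs_closed_deriv:
  assumes h: "\<And>i. h i \<in> cutoffs" and b: "b \<in> Basis"
  shows "\<exists>h'\<in>cutoffs. dir_deriv b (tensor h) = tensor (h(b := h'))"
proof -
  have "\<exists>g. \<forall>i. g i \<in> cutoffs \<and> (\<forall>s. (h i has_real_derivative g i s) (at s))"
    using cutoffs_closed_deriv[OF h] by (intro choice) blast
  then obtain g where g: "\<And>i. g i \<in> cutoffs" "\<And>i s. (h i has_real_derivative g i s) (at s)"
    by blast
  have "dir_deriv b (tensor h) x = tensor (h(b := g b)) x" for x
  proof -
    have "dir_deriv b (tensor h) x =
        (\<Sum>i\<in>Basis. (g i (x \<bullet> i) * (b \<bullet> i)) * (\<Prod>j\<in>Basis - {i}. h j (x \<bullet> j)))"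
      unfolding dir_deriv_def
      by (subst frechet_derivative_at[OF tensor_has_derivative[of h g x], symmetric]) (auto simp: g(2))
    also have "\<dots> = g b (x \<bullet> b) * (\<Prod>j\<in>Basis - {b}. h j (x \<bullet> j))"
      using b by (subst sum.remove[of Basis b]) (auto simp: inner_Basis intro!: sum.neutral split: if_splits)
    also have "\<dots> = tensor (h(b := g b)) x"
      unfolding tensor_def using b
      by (subst prod.remove[of Basis b]) auto
    finally show ?thesis .
  qed
  then show ?thesis using g(1)[of b] by blast
qed

text \<open>Every partial derivative is again a tensor product of cutoffs, so the induction on the order
  of smoothness must leave the factors arbitrary.\<close>

lemma Ck_on_tensor_cutoffs:
  assumes "\<And>i. h i \<in> cutoffs"
  shows "Ck_on k UNIV (tensor h)"
  using assms
proof (induction k arbitrary: h)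
  case (0 h)
  have "tensor h differentiable (at x)" for x
  proof -
    have "\<exists>g. \<forall>i. \<forall>s. (h i has_real_derivative g i s) (at s)"
      using cutoffs_closed_deriv[OF 0] by (intro choice) blast
    then obtain g where "\<And>i s. (h i has_real_derivative g i s) (at s)" by blast
    then show ?thesis using tensor_has_derivative differentiableI by blast
  qed
  then show ?case
    by (auto intro!: continuous_at_imp_continuous_on differentiable_imp_continuous_within)
next
  case (Suc k h)
  have "tensor h differentiable (at x)" for x
  proof -
    have "\<exists>g. \<forall>i. \<forall>s. (h i has_real_derivative g i s) (at s)"
      using cutoffs_closed_deriv[OF Suc.prems] by (intro choice) blast
    then obtain g where "\<And>i s. (h i has_real_derivative g i s) (at s)" by blast
    then show ?thesis using tensor_has_derivative differentiableI by blast
  qed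
  moreover have "Ck_on k UNIV (dir_deriv b (tensor h))" if "b \<in> Basis" for b
  proof -
    from tensor_cutoffs_closed_deriv[of h, OF Suc.prems that]
    obtain h' where h': "h' \<in> cutoffs" "dir_deriv b (tensor h) = tensor (h(b := h'))" ..
    have "(h(b := h')) i \<in> cutoffs" for i using h'(1) Suc.prems[of i] by simp
    then have "Ck_on k UNIV (tensor (h(b := h')))" by (rule Suc.IH)
    then show ?thesis by (simp only: h'(2))
  qed
  ultimately show ?case by simp
qed

text \<open>The factor \<open>k\<close> steepens the transition at the faces of the box; as \<open>k\<close> grows, the functions
  approach its indicator function.\<close>

definition box_bump :: "'a::euclidean_space \<Rightarrow> 'a \<Rightarrow> nat \<Rightarrow> 'a \<Rightarrow> real" where
  "box_bump a b k = tensor (\<lambda>i s. flat_exp 0 (real k * (s - a \<bullet> i)) * flat_exp 0 (real k * (b \<bullet> i - s)))"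

lemma flat_exp_0_bounds: "0 \<le> flat_exp 0 s" "flat_exp 0 s \<le> 1"
  by (auto simp: flat_exp_def)

lemma box_bump_bounds: "0 \<le> box_bump a b k x" "box_bump a b k x \<le> 1"
  unfolding box_bump_def tensor_def
  by (intro prod_nonneg ballI mult_nonneg_nonneg flat_exp_0_bounds)
     (intro prod_le_1 conjI mult_nonneg_nonneg mult_le_one flat_exp_0_bounds)

lemma box_bump_outside:
  assumes "x \<notin> box a b"
  shows "box_bump a b k x = 0"
proof -
  obtain i where i: "i \<in> Basis" "x \<bullet> i \<le> a \<bullet> i \<or> b \<bullet> i \<le> x \<bullet> i"
    using assms by (auto simp: mem_box not_less)
  then have "real k * (x \<bullet> i - a \<bullet> i) \<le> 0 \<or> real k * (b \<bullet> i - x \<bullet> i) \<le> 0"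
    by (auto simp: mult_nonneg_nonpos)
  then show ?thesis unfolding box_bump_def tensor_def
    by (intro prod_zero bexI[OF _ i(1)]) (auto simp: flat_exp_def)
qed

lemma box_bump_tendsto_1:
  assumes "x \<in> box a b"
  shows "(\<lambda>k. box_bump a b k x) \<longlonglongrightarrow> 1"
proof -
  have *: "(\<lambda>k. flat_exp 0 (real k * d)) \<longlonglongrightarrow> 1" if "d > 0" for d
  proof -
    have "(\<lambda>k. exp (- (inverse (real k) * inverse d))) \<longlonglongrightarrow> exp (- (0 * inverse d))"
      by (intro tendsto_intros lim_inverse_n)
    moreover have "eventually (\<lambda>k. exp (- (inverse (real k) * inverse d)) = flat_exp 0 (real k * d)) sequentially"
      using eventually_gt_at_top[of 0]
      by eventually_elim (use that in \<open>simp add: flat_exp_def field_simps\<close>)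
    ultimately show ?thesis by (simp add: Lim_transform_eventually)
  qed
  have "(\<lambda>k. box_bump a b k x) \<longlonglongrightarrow> (\<Prod>i\<in>(Basis::'a set). 1 * 1)"
    unfolding box_bump_def tensor_def using assms
    by (intro tendsto_prod tendsto_mult *) (auto simp: mem_box)
  then show ?thesis by simp
qed

lemma box_bump_test_function:
  assumes "cbox a b \<subseteq> Q"
  shows "test_function Q (box_bump a b k)"
proof -
  have "(\<lambda>s. flat_exp 0 (real k * (s - a \<bullet> i)) * flat_exp 0 (real k * (b \<bullet> i - s))) \<in> cutoffs" for i
  proof -
    have "(\<lambda>s. flat_exp 0 (real k * s + - real k * (a \<bullet> i)) * flat_exp 0 (- real k * s + real k * (b \<bullet> i))) \<in> cutoffs"
      by (intro cutoffs.intros)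
    then show ?thesis by (simp add: algebra_simps)
  qed
  then have "\<forall>n. Ck_on n UNIV (box_bump a b k)"
    unfolding box_bump_def by (intro allI Ck_on_tensor_cutoffs)
  moreover have "closure {x. box_bump a b k x \<noteq> 0} \<subseteq> cbox a b"
    using box_bump_outside[of _ a b k] box_subset_cbox[of a b] by (intro closure_minimal) auto
  ultimately show ?thesis unfolding test_function_def
    using assms by (meson bounded_cbox bounded_subset closed_closure compact_eq_bounded_closed subset_trans)
qed

text \<open>Fundamental lemma of the calculus of variations. By dominated convergence along the bumps,
  the integral of \<open>w\<close> over each closed box in \<open>Q\<close> is zero. By Lebesgue's differentiation theorem
  the averages over small boxes with a corner at \<open>x\<close> tend to \<open>w x\<close> for almost all \<open>x\<close>.\<close>

lemma test_function_orthogonal_imp_AE_0: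
  fixes w :: "'a::euclidean_space \<Rightarrow> real"
  assumes Q: "open Q" and w: "integrable (lebesgue_on Q) w"
    and orth: "\<And>\<phi>. test_function Q \<phi> \<Longrightarrow> (LINT x|lebesgue_on Q. w x * \<phi> x) = 0"
  shows "AE x in lebesgue_on Q. w x = 0"
proof -
  have Qm: "Q \<in> sets lebesgue" using Q by auto
  define f where "f x = (if x \<in> Q then w x else 0)" for x
  have fi: "integrable lebesgue f"
  proof -
    have "integrable lebesgue (\<lambda>x. indicator Q x *\<^sub>R w x)"
      using w Qm by (simp add: integrable_restrict_space)
    also have "(\<lambda>x. indicator Q x *\<^sub>R w x) = f"
      by (auto simp: f_def indicator_def)
    finally show ?thesis .
  qed
  have box0: "integral (cbox a b) f = 0" if ab: "cbox a b \<subseteq> Q" for a b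
  proof -
    have "(\<lambda>k. LINT x|lebesgue_on Q. w x * box_bump a b k x) \<longlonglongrightarrow>
        (LINT x|lebesgue_on Q. w x * indicator (box a b) x)"
    proof (rule integral_dominated_convergence[where w="\<lambda>x. \<bar>w x\<bar>"])
      show "(\<lambda>x. w x * indicator (box a b) x) \<in> borel_measurable (lebesgue_on Q)"
        by (intro borel_measurable_times borel_measurable_integrable[OF w]
            measurable_restrict_space1 borel_measurable_indicator) auto
      show "(\<lambda>x. w x * box_bump a b k x) \<in> borel_measurable (lebesgue_on Q)" for k
      proof -
        have "continuous_on UNIV (box_bump a b k)"
          using box_bump_test_function[OF ab, of k] unfolding test_function_def
          by (metis Ck_on.simps(1))
        then have "box_bump a b k \<in> borel_measurable (lebesgue_on Q)"
          by (rule continuous_imp_measurable_on_sets_lebesgue[OF continuous_on_subset[OF _ subset_UNIV] Qm])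
        then show ?thesis using w by (intro borel_measurable_times) auto
      qed
      show "integrable (lebesgue_on Q) (\<lambda>x. \<bar>w x\<bar>)" using w by simp
      show "AE x in lebesgue_on Q. (\<lambda>k. w x * box_bump a b k x) \<longlonglongrightarrow> w x * indicator (box a b) x"
      proof (rule AE_I2, rule tendsto_mult_left)
        fix x show "(\<lambda>k. box_bump a b k x) \<longlonglongrightarrow> indicator (box a b) x"
          using box_bump_tendsto_1[of x a b] box_bump_outside[of x a b] by (cases "x \<in> box a b") auto
      qed
      show "AE x in lebesgue_on Q. norm (w x * box_bump a b k x) \<le> \<bar>w x\<bar>" for k
        using box_bump_bounds[of a b k] by (intro AE_I2) (simp add: abs_mult mult_left_le)
    qed
    then have "(LINT x|lebesgue_on Q. w x * indicator (box a b) x) = 0"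
      using orth[OF box_bump_test_function[OF ab]] by (simp add: LIMSEQ_const_iff)
    moreover have "(LINT x|lebesgue_on Q. w x * indicator (box a b) x) =
        (LINT x|lebesgue_on (box a b). f x)"
    proof -
      have "(LINT x|lebesgue_on Q. w x * indicator (box a b) x) =
         (LINT x|lebesgue. indicator Q x *\<^sub>R (w x * indicator (box a b) x))"
        by (rule integral_restrict_space) (use Qm in auto)
      also have "\<dots> = (LINT x|lebesgue. indicator (box a b) x *\<^sub>R f x)"
        using ab box_subset_cbox[of a b]
        by (intro Bochner_Integration.integral_cong) (auto simp: f_def indicator_def)
      also have "\<dots> = (LINT x|lebesgue_on (box a b). f x)"
        by (rule integral_restrict_space[symmetric]) auto
      finally show ?thesis .
    qed
    moreover have "(LINT x|lebesgue_on (box a b). f x) = integral (box a b) f"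
    proof (rule lebesgue_integral_eq_integral)
      have "integrable lebesgue (\<lambda>x. indicator (box a b) x *\<^sub>R f x)"
        by (rule integrable_mult_indicator[OF _ fi]) auto
      then show "integrable (lebesgue_on (box a b)) f"
        by (simp add: integrable_restrict_space)
    qed auto
    ultimately show ?thesis by (simp add: integral_open_interval)
  qed
  have fint: "f integrable_on cbox a b" for a b
    using integrable_on_subcbox[OF integrable_on_lebesgue[OF fi], of a b] by simp
  obtain N where N: "negligible N" "\<And>x e. \<lbrakk>x \<notin> N; 0 < e\<rbrakk> \<Longrightarrow>
     \<exists>d>0. \<forall>h. 0 < h \<and> h < d \<longrightarrow>
       norm (integral (cbox x (x + h *\<^sub>R One)) f /\<^sub>R h ^ DIM('a) - f x) < e"
    using integrable_ccontinuous_explicit[OF fint] by metis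
  have "w x = 0" if x: "x \<in> Q" "x \<notin> N" for x
  proof (rule ccontr)
    assume "w x \<noteq> 0"
    then obtain d where d: "d > 0" "\<And>h. 0 < h \<and> h < d \<Longrightarrow>
       norm (integral (cbox x (x + h *\<^sub>R One)) f /\<^sub>R h ^ DIM('a) - f x) < \<bar>w x\<bar>"
      using N(2)[OF x(2), of "\<bar>w x\<bar>"] by auto
    obtain e where e: "e > 0" "cball x e \<subseteq> Q"
      using Q x(1) open_contains_cball by blast
    \<comment> \<open>A cube of side \<open>e / DIM('a)\<close> has diameter at most \<open>e\<close> in the \<open>l\<^sub>1\<close> norm, so it fits into the ball.\<close>
    define h where "h = min (d / 2) (e / DIM('a))"
    have "h \<le> e / DIM('a)" by (simp add: h_def)
    then have "h * DIM('a) \<le> e" by (simp add: pos_le_divide_eq)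
    moreover have "0 < h" "h < d" using d(1) e(1) by (auto simp: h_def)
    ultimately have h: "0 < h" "h < d" "h * DIM('a) \<le> e" by auto
    have "cbox x (x + h *\<^sub>R One) \<subseteq> cball x e"
    proof
      fix y assume y: "y \<in> cbox x (x + h *\<^sub>R One)"
      have "norm (y - x) \<le> (\<Sum>i\<in>Basis. \<bar>(y - x) \<bullet> i\<bar>)" by (rule norm_le_l1)
      also have "\<dots> \<le> (\<Sum>i\<in>(Basis::'a set). h)"
        using y by (intro sum_mono) (simp add: mem_box inner_add_left inner_diff_left abs_le_iff diff_le_eq add.commute)
      finally show "y \<in> cball x e" using h(3) by (simp add: dist_norm norm_minus_commute mult.commute)
    qed
    then have "integral (cbox x (x + h *\<^sub>R One)) f = 0" using box0 e(2) by blast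
    then show False using d(2)[of h] h x by (simp add: f_def)
  qed
  then have "{x \<in> Q. w x \<noteq> 0} \<subseteq> N" by blast
  moreover have "N \<in> null_sets lebesgue" using N(1) by (simp add: negligible_iff_null_sets)
  ultimately have "AE x in lebesgue. x \<in> Q \<longrightarrow> w x = 0"
    by (intro AE_I'[of N]) auto
  then show ?thesis by (subst AE_restrict_space_iff) (use Qm in auto)
qed

section \<open>The space of square-integrable functions\<close>

text \<open>Letting \<open>e\<close> tend to zero gives sharp estimates for small \<open>b\<close>; the case \<open>e = 1\<close> is the
  familiar bound by twice the sum of the squares.\<close>

lemma Young_power2_sum:
  fixes a b e :: real
  assumes "e > 0"
  shows "(a + b)\<^sup>2 \<le> (1 + e) * a\<^sup>2 + (1 + 1 / e) * b\<^sup>2"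
proof -
  have "0 \<le> (e * a - b)\<^sup>2 / e" using assms by simp
  also have "\<dots> = e * a\<^sup>2 - 2 * a * b + b\<^sup>2 / e"
    using assms by (simp add: power2_eq_square field_simps)
  finally show ?thesis by (simp add: power2_sum algebra_simps)
qed

lemma L2_measurable [measurable_dest]: "f \<in> L2 M \<Longrightarrow> f \<in> borel_measurable M"
  and L2_integrable_power2: "f \<in> L2 M \<Longrightarrow> integrable M (\<lambda>x. (f x)\<^sup>2)"
  by (auto simp: L2_def)

lemma L2_dominated:
  assumes "integrable M h" "f \<in> borel_measurable M" "AE x in M. (f x)\<^sup>2 \<le> h x"
  shows "f \<in> L2 M"
  unfolding L2_def using assms
  by (auto intro!: Bochner_Integration.integrable_bound[OF assms(1)] borel_measurable_power elim: AE_mp)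

lemma L2_scale: "f \<in> L2 M \<Longrightarrow> (\<lambda>x. c * f x) \<in> L2 M"
  by (auto simp: L2_def power_mult_distrib)

lemma L2_add:
  assumes "f \<in> L2 M" "g \<in> L2 M"
  shows "(\<lambda>x. f x + g x) \<in> L2 M"
proof (rule L2_dominated[where h="\<lambda>x. 2 * (f x)\<^sup>2 + 2 * (g x)\<^sup>2"])
  have "(f x + g x)\<^sup>2 \<le> 2 * (f x)\<^sup>2 + 2 * (g x)\<^sup>2" for x
    using zero_le_power2[of "f x - g x"] by (simp add: power2_sum power2_diff)
  then show "AE x in M. (f x + g x)\<^sup>2 \<le> 2 * (f x)\<^sup>2 + 2 * (g x)\<^sup>2" by simp
qed (use assms in \<open>auto simp: L2_def\<close>)

lemma L2_lincomb:
  assumes "f \<in> L2 M" "g \<in> L2 M"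
  shows "(\<lambda>x. c * f x + d * g x) \<in> L2 M"
  using assms by (intro L2_add L2_scale)

lemma L2_diff:
  assumes "f \<in> L2 M" "g \<in> L2 M"
  shows "(\<lambda>x. f x - g x) \<in> L2 M"
  using L2_lincomb[OF assms, of 1 "-1"] by simp

lemma L2_sum:
  assumes "finite I" "\<And>i. i \<in> I \<Longrightarrow> f i \<in> L2 M"
  shows "(\<lambda>x. \<Sum>i\<in>I. f i x) \<in> L2 M"
  using assms
proof (induction I rule: finite_induct)
  case empty
  show ?case by (simp add: L2_def)
next
  case (insert i I)
  then show ?case by (auto intro: L2_add)
qed

lemma L2_mult_bounded:
  assumes f: "f \<in> L2 M" and k: "k \<in> borel_measurable M" "\<And>x. x \<in> space M \<Longrightarrow> \<bar>k x\<bar> \<le> B"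
  shows "(\<lambda>x. k x * f x) \<in> L2 M"
proof (rule L2_dominated[where h="\<lambda>x. B\<^sup>2 * (f x)\<^sup>2"])
  show "AE x in M. (k x * f x)\<^sup>2 \<le> B\<^sup>2 * (f x)\<^sup>2"
  proof (rule AE_I2)
    fix x assume "x \<in> space M"
    then have "\<bar>k x\<bar>\<^sup>2 \<le> B\<^sup>2" using k(2) by (intro power_mono) auto
    then show "(k x * f x)\<^sup>2 \<le> B\<^sup>2 * (f x)\<^sup>2"
      by (simp add: power_mult_distrib mult_right_mono)
  qed
qed (use f k in \<open>auto simp: L2_def\<close>)

lemma L2_mult_integrable:
  assumes "f \<in> L2 M" "g \<in> L2 M"
  shows "integrable M (\<lambda>x. f x * g x)"
proof (rule Bochner_Integration.integrable_bound[where f="\<lambda>x. (f x)\<^sup>2 + (g x)\<^sup>2"])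
  have "\<bar>f x * g x\<bar> \<le> (f x)\<^sup>2 + (g x)\<^sup>2" for x
  proof -
    have "2 * (\<bar>f x\<bar> * \<bar>g x\<bar>) \<le> (f x)\<^sup>2 + (g x)\<^sup>2"
      using zero_le_power2[of "\<bar>f x\<bar> - \<bar>g x\<bar>"] by (simp add: power2_diff)
    moreover have "0 \<le> \<bar>f x\<bar> * \<bar>g x\<bar>" by simp
    ultimately show ?thesis unfolding abs_mult by linarith
  qed
  then show "AE x in M. norm (f x * g x) \<le> norm ((f x)\<^sup>2 + (g x)\<^sup>2)" by simp
qed (use assms in \<open>auto simp: L2_def\<close>)

text \<open>The inner product of the error with \<open>g\<close> is estimated by
  \<open>\<parallel>f n - f'\<parallel>\<^sup>2 / d + d \<parallel>g\<parallel>\<^sup>2\<close>, where \<open>d\<close> is chosen first to make the second term small.\<close>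

lemma L2_tendsto_inner:
  assumes f: "\<And>n. f n \<in> L2 M" "f' \<in> L2 M" and g: "g \<in> L2 M"
    and lim: "(\<lambda>n. LINT x|M. (f n x - f' x)\<^sup>2) \<longlonglongrightarrow> 0"
  shows "(\<lambda>n. LINT x|M. f n x * g x) \<longlonglongrightarrow> (LINT x|M. f' x * g x)"
proof (rule LIMSEQ_I)
  fix e :: real assume e: "e > 0"
  define G where "G = (LINT x|M. (g x)\<^sup>2)"
  have G: "G \<ge> 0" by (simp add: G_def)
  \<comment> \<open>\<open>G + 1\<close> instead of \<open>G\<close> covers the case that \<open>g\<close> vanishes.\<close>
  define d where "d = e / (2 * (G + 1))"
  have d: "d > 0" "d * G < e / 2" using e G by (auto simp: d_def field_simps)
  obtain N where N: "\<And>n. n \<ge> N \<Longrightarrow> (LINT x|M. (f n x - f' x)\<^sup>2) < d * e / 2"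
    using LIMSEQ_D[OF lim, of "d * e / 2"] d e by auto
  have "norm ((LINT x|M. f n x * g x) - (LINT x|M. f' x * g x)) < e" if n: "n \<ge> N" for n
  proof -
    let ?r = "\<lambda>x. f n x - f' x"
    have r: "?r \<in> L2 M" using f by (intro L2_diff) auto
    have pt: "\<bar>?r x * g x\<bar> \<le> (?r x)\<^sup>2 / d + d * (g x)\<^sup>2" for x
    proof -
      have "2 * (\<bar>?r x\<bar> * \<bar>g x\<bar>) \<le> (?r x)\<^sup>2 / d + d * (g x)\<^sup>2"
        using zero_le_power2[of "\<bar>?r x\<bar> - d * \<bar>g x\<bar>"] d(1)
        by (simp add: power2_diff field_simps power2_eq_square)
      moreover have "0 \<le> \<bar>?r x\<bar> * \<bar>g x\<bar>" by simp
      ultimately show ?thesis unfolding abs_mult by linarith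
    qed
    have "(LINT x|M. f n x * g x) - (LINT x|M. f' x * g x) = (LINT x|M. ?r x * g x)"
      using f g by (subst Bochner_Integration.integral_diff[symmetric])
        (auto intro: L2_mult_integrable simp: left_diff_distrib)
    also have "norm \<dots> \<le> (LINT x|M. \<bar>?r x * g x\<bar>)"
      using integral_norm_bound[of M "\<lambda>x. ?r x * g x"] by simp
    also have "\<dots> \<le> (LINT x|M. (?r x)\<^sup>2 / d + d * (g x)\<^sup>2)"
    proof (rule integral_mono)
      show "integrable M (\<lambda>x. \<bar>?r x * g x\<bar>)" using L2_mult_integrable[OF r g] by simp
      show "integrable M (\<lambda>x. (?r x)\<^sup>2 / d + d * (g x)\<^sup>2)"
        using L2_integrable_power2[OF r] L2_integrable_power2[OF g] by simp
    qed (rule pt)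
    also have "\<dots> = (LINT x|M. (?r x)\<^sup>2) / d + d * G"
      using L2_integrable_power2[OF r] L2_integrable_power2[OF g] by (simp add: G_def)
    also have "\<dots> < e / 2 + e / 2"
      using N[OF n] d by (intro add_strict_mono) (auto simp: field_simps)
    finally show ?thesis by simp
  qed
  then show "\<exists>N. \<forall>n\<ge>N. norm ((LINT x|M. f n x * g x) - (LINT x|M. f' x * g x)) < e" by blast
qed

text \<open>The theorem of Riesz and Fischer on a space of finite measure. There an \<open>L\<^sub>2\<close> Cauchy sequence is
  also an \<open>L\<^sub>1\<close> Cauchy sequence, hence a subsequence converges almost everywhere; Fatou's lemma along
  this subsequence shows that its pointwise limit is the limit in \<open>L\<^sub>2\<close>.\<close>

lemma L2_complete:
  fixes s :: "nat \<Rightarrow> 'a \<Rightarrow> real"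
  assumes M: "finite_measure M" and s: "\<And>n. s n \<in> L2 M"
    and Cauchy: "\<And>e. e > 0 \<Longrightarrow> \<exists>N. \<forall>i\<ge>N. \<forall>j\<ge>N. (LINT x|M. (s i x - s j x)\<^sup>2) < e"
  shows "\<exists>f\<in>L2 M. (\<lambda>n. LINT x|M. (s n x - f x)\<^sup>2) \<longlonglongrightarrow> 0"
proof -
  interpret finite_measure M by fact
  have d: "(\<lambda>x. s i x - s j x) \<in> L2 M" for i j using s by (intro L2_diff)
  have int: "integrable M f" if "f \<in> L2 M" for f :: "'a \<Rightarrow> real"
    by (rule square_integrable_imp_integrable[OF L2_measurable[OF that] L2_integrable_power2[OF that]])
  have L1: "\<exists>N. \<forall>i\<ge>N. \<forall>j\<ge>N. (LINT x|M. norm (s i x - s j x)) < e" if e: "e > 0" for e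
  proof -
    let ?m = "measure M (space M)"
    define t where "t = e / (2 * (?m + 1))"
    have m: "?m + 1 > 0" using measure_nonneg[of M "space M"] by linarith
    have "t > 0" unfolding t_def using e m by (intro divide_pos_pos) auto
    moreover have "t * (?m + 1) = e / 2" unfolding t_def using m by (simp add: field_simps)
    ultimately have t: "t > 0" "t * ?m < e / 2" by (simp_all add: algebra_simps)
    obtain N where N: "\<And>i j. i \<ge> N \<Longrightarrow> j \<ge> N \<Longrightarrow> (LINT x|M. (s i x - s j x)\<^sup>2) < t * e / 2"
      using Cauchy[of "t * e / 2"] t e by auto
    have "(LINT x|M. norm (s i x - s j x)) < e" if ij: "i \<ge> N" "j \<ge> N" for i j
    proof -
      have pt: "\<bar>y\<bar> \<le> y\<^sup>2 / t + t" for y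
      proof -
        have "2 * \<bar>y\<bar> \<le> y\<^sup>2 / t + t"
          using zero_le_power2[of "\<bar>y\<bar> - t"] t(1) by (simp add: power2_diff field_simps power2_eq_square)
        then show ?thesis by linarith
      qed
      have "(LINT x|M. norm (s i x - s j x)) \<le> (LINT x|M. (s i x - s j x)\<^sup>2 / t + t)"
      proof (rule integral_mono)
        show "integrable M (\<lambda>x. norm (s i x - s j x))" using int[OF d] by (rule integrable_norm)
        show "integrable M (\<lambda>x. (s i x - s j x)\<^sup>2 / t + t)"
          using L2_integrable_power2[OF d] by simp
        show "norm (s i x - s j x) \<le> (s i x - s j x)\<^sup>2 / t + t" for x
          using pt by simp
      qed
      also have "\<dots> = (LINT x|M. (s i x - s j x)\<^sup>2) / t + t * ?m"
        using L2_integrable_power2[OF d] by simp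
      also have "\<dots> < e / 2 + e / 2"
        using N[OF ij] t by (intro add_strict_mono) (auto simp: field_simps)
      finally show ?thesis by simp
    qed
    then show ?thesis by blast
  qed
  obtain r where r: "strict_mono r" "AE x in M. Cauchy (\<lambda>i. s (r i) x)"
    using cauchy_L1_AE_cauchy_subseq[of M s] int[OF s] L1 by blast
  define f where "f x = lim (\<lambda>i. s (r i) x)" for x
  have sm: "s n \<in> borel_measurable M" for n using s by (auto simp: L2_def)
  have fm: "f \<in> borel_measurable M"
    unfolding f_def[abs_def] by (intro borel_measurable_lim_metric sm)
  have lim: "AE x in M. (\<lambda>i. s (r i) x) \<longlonglongrightarrow> f x"
    using r(2) by eventually_elim (simp add: f_def Cauchy_convergent_iff convergent_LIMSEQ_iff)
  have bound: "\<exists>N. \<forall>n\<ge>N. (\<integral>\<^sup>+x. ennreal ((s n x - f x)\<^sup>2) \<partial>M) \<le> ennreal e" if e: "e > 0" for e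
  proof -
    obtain N where N: "\<And>i j. i \<ge> N \<Longrightarrow> j \<ge> N \<Longrightarrow> (LINT x|M. (s i x - s j x)\<^sup>2) < e"
      using Cauchy[OF e] by blast
    have "(\<integral>\<^sup>+x. ennreal ((s n x - f x)\<^sup>2) \<partial>M) \<le> ennreal e" if n: "n \<ge> N" for n
    proof -
      have "(\<integral>\<^sup>+x. ennreal ((s n x - f x)\<^sup>2) \<partial>M) =
          (\<integral>\<^sup>+x. liminf (\<lambda>j. ennreal ((s n x - s (r j) x)\<^sup>2)) \<partial>M)"
      proof (rule nn_integral_cong_AE)
        show "AE x in M. ennreal ((s n x - f x)\<^sup>2) = liminf (\<lambda>j. ennreal ((s n x - s (r j) x)\<^sup>2))"
          using lim
        proof eventually_elim
          case (elim x)
          have "(\<lambda>j. ennreal ((s n x - s (r j) x)\<^sup>2)) \<longlonglongrightarrow> ennreal ((s n x - f x)\<^sup>2)"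
            using elim by (intro tendsto_ennrealI tendsto_intros)
          from lim_imp_Liminf[OF trivial_limit_sequentially this] show ?case ..
        qed
      qed
      also have "\<dots> \<le> liminf (\<lambda>j. \<integral>\<^sup>+x. ennreal ((s n x - s (r j) x)\<^sup>2) \<partial>M)"
        using sm by (intro nn_integral_liminf) measurable
      also have "\<dots> \<le> limsup (\<lambda>j. \<integral>\<^sup>+x. ennreal ((s n x - s (r j) x)\<^sup>2) \<partial>M)"
        by (intro Liminf_le_Limsup) simp
      also have "\<dots> \<le> ennreal e"
      proof (rule Limsup_bounded)
        have "(\<integral>\<^sup>+x. ennreal ((s n x - s (r j) x)\<^sup>2) \<partial>M) \<le> ennreal e" if "j \<ge> N" for j
        proof -
          have "r j \<ge> N" using that seq_suble[OF r(1), of j] by simp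
          then show ?thesis using N[OF n, of "r j"] L2_integrable_power2[OF d]
            by (subst nn_integral_eq_integral) (auto intro!: ennreal_leI)
        qed
        then show "\<forall>\<^sub>F j in sequentially. (\<integral>\<^sup>+x. ennreal ((s n x - s (r j) x)\<^sup>2) \<partial>M) \<le> ennreal e"
          by (auto simp: eventually_sequentially)
      qed
      finally show ?thesis .
    qed
    then show ?thesis by blast
  qed
  have diffL2: "(\<lambda>x. s n x - f x) \<in> L2 M"
    if "(\<integral>\<^sup>+x. ennreal ((s n x - f x)\<^sup>2) \<partial>M) \<le> ennreal e" for n e
  proof -
    have "integrable M (\<lambda>x. (s n x - f x)\<^sup>2)"
      using that sm fm by (intro integrableI_bounded) (auto simp: top.extremum_strict le_less_trans)
    then show ?thesis using sm fm by (simp add: L2_def)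
  qed
  obtain N where "(\<integral>\<^sup>+x. ennreal ((s N x - f x)\<^sup>2) \<partial>M) \<le> ennreal 1"
    using bound[of 1] by auto
  from L2_diff[OF s[of N] diffL2[OF this]] have fL2: "f \<in> L2 M" by simp
  have "(\<lambda>n. LINT x|M. (s n x - f x)\<^sup>2) \<longlonglongrightarrow> 0"
  proof (rule LIMSEQ_I)
    fix e :: real assume e: "e > 0"
    obtain N where N: "\<And>n. n \<ge> N \<Longrightarrow> (\<integral>\<^sup>+x. ennreal ((s n x - f x)\<^sup>2) \<partial>M) \<le> ennreal (e / 2)"
      using bound[of "e / 2"] e by auto
    have "norm ((LINT x|M. (s n x - f x)\<^sup>2) - 0) < e" if "n \<ge> N" for n
    proof -
      have "ennreal (LINT x|M. (s n x - f x)\<^sup>2) \<le> ennreal (e / 2)"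
        using N[OF that] L2_integrable_power2[OF L2_diff[OF s fL2]]
        by (subst nn_integral_eq_integral[symmetric]) auto
      then show ?thesis using e by (simp add: ennreal_le_iff)
    qed
    then show "\<exists>N. \<forall>n\<ge>N. norm ((LINT x|M. (s n x - f x)\<^sup>2) - 0) < e" by blast
  qed
  then show ?thesis using fL2 by blast
qed

lemma L2_cong:
  assumes "f \<in> L2 M" "\<And>x. x \<in> space M \<Longrightarrow> g x = f x"
  shows "g \<in> L2 M"
proof -
  have "g \<in> borel_measurable M"
    using L2_measurable[OF assms(1)] by (subst measurable_cong[of M g f]) (simp_all add: assms(2))
  moreover have "integrable M (\<lambda>x. (g x)\<^sup>2)"
    using L2_integrable_power2[OF assms(1)]
    by (subst Bochner_Integration.integrable_cong[of M M _ "\<lambda>x. (f x)\<^sup>2"]) (simp_all add: assms(2))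
  ultimately show ?thesis by (simp add: L2_def)
qed

section \<open>Continuous functions on the closure of a bounded open set\<close>

lemma continuous_on_closure_bounded:
  fixes f :: "'a::euclidean_space \<Rightarrow> real"
  assumes "bounded Q" "continuous_on (closure Q) f"
  obtains B where "\<And>x. x \<in> Q \<Longrightarrow> \<bar>f x\<bar> \<le> B"
proof -
  have "compact (f ` closure Q)"
    using assms by (intro compact_continuous_image) (auto simp: compact_closure)
  then obtain B where "\<forall>y\<in>f ` closure Q. norm y \<le> B"
    using compact_imp_bounded bounded_iff by metis
  then have "\<bar>f x\<bar> \<le> B" if "x \<in> Q" for x using that closure_subset by force
  then show ?thesis by (rule that)
qed

lemma continuous_on_closure_measurable:
  assumes "open Q" "continuous_on (closure Q) f"
  shows "f \<in> borel_measurable (lebesgue_on Q)"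
  by (rule continuous_imp_measurable_on_sets_lebesgue[OF continuous_on_subset[OF assms(2) closure_subset]])
     (use assms(1) in auto)

lemma finite_measure_lebesgue_on_open:
  fixes Q :: "'a::euclidean_space set"
  assumes "open Q" "bounded Q"
  shows "finite_measure (lebesgue_on Q)"
  using assms by (intro finite_measure_lebesgue_on bounded_set_imp_lmeasurable) auto

lemma L2_imp_integrable:
  assumes "finite_measure M" "f \<in> L2 M"
  shows "integrable M f"
  by (rule finite_measure.square_integrable_imp_integrable[OF assms(1) L2_measurable[OF assms(2)]
        L2_integrable_power2[OF assms(2)]])

lemma continuous_on_closure_L2:
  fixes f :: "'a::euclidean_space \<Rightarrow> real"
  assumes "open Q" "bounded Q" "continuous_on (closure Q) f"
  shows "f \<in> L2 (lebesgue_on Q)"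
proof -
  interpret finite_measure "lebesgue_on Q" using assms by (intro finite_measure_lebesgue_on_open)
  obtain B where B: "\<And>x. x \<in> Q \<Longrightarrow> \<bar>f x\<bar> \<le> B"
    using continuous_on_closure_bounded[OF assms(2,3)] by blast
  have "(\<lambda>x. f x * 1) \<in> L2 (lebesgue_on Q)"
  proof (rule L2_mult_bounded[where B=B])
    show "(\<lambda>x. 1) \<in> L2 (lebesgue_on Q)" by (simp add: L2_def)
    show "f \<in> borel_measurable (lebesgue_on Q)"
      using assms(1,3) by (rule continuous_on_closure_measurable)
  qed (use B in simp)
  then show ?thesis by simp
qed

section \<open>Weak derivatives\<close>

lemma Ck_on_foldr_dir_deriv:
  "Ck_on (k + length bs) UNIV \<phi> \<Longrightarrow> set bs \<subseteq> Basis \<Longrightarrow> Ck_on k UNIV (foldr dir_deriv bs \<phi>)"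
proof (induction bs arbitrary: k)
  case (Cons b bs)
  have "Ck_on (Suc k) UNIV (foldr dir_deriv bs \<phi>)"
    using Cons.prems by (intro Cons.IH) simp_all
  then show ?case using Cons.prems(2) by simp
qed simp

lemma test_function_deriv_L2:
  assumes Q: "open Q" "bounded Q" and "test_function Q \<phi>" "set bs \<subseteq> Basis"
  shows "foldr dir_deriv bs \<phi> \<in> L2 (lebesgue_on Q)"
proof -
  have "Ck_on 0 UNIV (foldr dir_deriv bs \<phi>)"
    using assms by (intro Ck_on_foldr_dir_deriv) (auto simp: test_function_def)
  then show ?thesis
    using continuous_on_subset[OF _ subset_UNIV] by (intro continuous_on_closure_L2[OF Q]) simp
qed

lemma test_function_L2:
  assumes "open Q" "bounded Q" "test_function Q \<phi>"
  shows "\<phi> \<in> L2 (lebesgue_on Q)"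
  using test_function_deriv_L2[OF assms, of "[]"] by simp

lemma has_weak_deriv_L2:
  assumes "has_weak_deriv Q \<beta> u w"
  shows "u \<in> L2 (lebesgue_on Q)" "w \<in> L2 (lebesgue_on Q)"
  using assms unfolding has_weak_deriv_def by blast+

lemma has_weak_derivD:
  assumes "has_weak_deriv Q (mset bs) u w" "test_function Q \<phi>"
  shows "(LINT x|lebesgue_on Q. u x * foldr dir_deriv bs \<phi> x) =
    (- 1) ^ length bs * (LINT x|lebesgue_on Q. w x * \<phi> x)"
  using assms by (simp add: has_weak_deriv_def)

lemma has_weak_deriv_empty: "u \<in> L2 (lebesgue_on Q) \<Longrightarrow> has_weak_deriv Q {#} u u"
  by (auto simp: has_weak_deriv_def)

text \<open>The difference of two weak derivatives is orthogonal to all test functions.\<close>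

lemma has_weak_deriv_unique:
  assumes Q: "open Q" "bounded Q" and w: "has_weak_deriv Q \<beta> u w" "has_weak_deriv Q \<beta> u w'"
  shows "AE x in lebesgue_on Q. w x = w' x"
proof -
  have L2: "w \<in> L2 (lebesgue_on Q)" "w' \<in> L2 (lebesgue_on Q)"
    using w by (auto dest: has_weak_deriv_L2)
  obtain bs where bs: "mset bs = \<beta>" using ex_mset by blast
  have "AE x in lebesgue_on Q. w x - w' x = 0"
  proof (rule test_function_orthogonal_imp_AE_0[OF Q(1)])
    show "integrable (lebesgue_on Q) (\<lambda>x. w x - w' x)"
      using L2 Q by (intro L2_imp_integrable L2_diff finite_measure_lebesgue_on_open)
    fix \<phi> assume \<phi>: "test_function Q \<phi>"
    from has_weak_derivD[OF w(1)[folded bs] \<phi>] has_weak_derivD[OF w(2)[folded bs] \<phi>]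
    have "(LINT x|lebesgue_on Q. w x * \<phi> x) = (LINT x|lebesgue_on Q. w' x * \<phi> x)"
      by simp
    then show "(LINT x|lebesgue_on Q. (w x - w' x) * \<phi> x) = 0"
      using L2 test_function_L2[OF Q \<phi>] by (simp add: left_diff_distrib L2_mult_integrable)
  qed
  then show ?thesis by simp
qed

lemma has_weak_deriv_lincomb:
  assumes Q: "open Q" "bounded Q" and \<beta>: "set_mset \<beta> \<subseteq> Basis"
    and u: "has_weak_deriv Q \<beta> u u'" and v: "has_weak_deriv Q \<beta> v v'"
  shows "has_weak_deriv Q \<beta> (\<lambda>x. c * u x + d * v x) (\<lambda>x. c * u' x + d * v' x)"
proof -
  have L2: "u \<in> L2 (lebesgue_on Q)" "u' \<in> L2 (lebesgue_on Q)" "v \<in> L2 (lebesgue_on Q)" "v' \<in> L2 (lebesgue_on Q)"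
    using u v by (auto dest: has_weak_deriv_L2)
  have lin: "(LINT x|lebesgue_on Q. (c * f x + d * g x) * \<psi> x) =
      c * (LINT x|lebesgue_on Q. f x * \<psi> x) + d * (LINT x|lebesgue_on Q. g x * \<psi> x)"
    if "f \<in> L2 (lebesgue_on Q)" "g \<in> L2 (lebesgue_on Q)" "\<psi> \<in> L2 (lebesgue_on Q)" for f g \<psi>
    using that by (simp add: distrib_right mult.assoc L2_mult_integrable)
  have "(LINT x|lebesgue_on Q. (c * u x + d * v x) * foldr dir_deriv bs \<phi> x) =
      (- 1) ^ size \<beta> * (LINT x|lebesgue_on Q. (c * u' x + d * v' x) * \<phi> x)"
    if \<phi>: "test_function Q \<phi>" and bs: "mset bs = \<beta>" for \<phi> bs
  proof -
    have "set bs \<subseteq> Basis" using bs \<beta> by auto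
    note \<psi> = test_function_deriv_L2[OF Q \<phi> this] test_function_L2[OF Q \<phi>]
    have "size \<beta> = length bs" using bs by auto
    then show ?thesis
      unfolding lin[OF L2(1,3) \<psi>(1)] lin[OF L2(2,4) \<psi>(2)]
        has_weak_derivD[OF u[folded bs] \<phi>] has_weak_derivD[OF v[folded bs] \<phi>]
      by (simp add: algebra_simps)
  qed
  then show ?thesis using L2 by (auto simp: has_weak_deriv_def intro: L2_lincomb)
qed

text \<open>Both sides of the defining identity are inner products with a fixed square-integrable
  function and therefore pass to the limit.\<close>

lemma has_weak_deriv_limit:
  assumes Q: "open Q" "bounded Q" and \<beta>: "set_mset \<beta> \<subseteq> Basis"
    and d: "\<And>n. has_weak_deriv Q \<beta> (u n) (w n)"
    and L2: "u' \<in> L2 (lebesgue_on Q)" "w' \<in> L2 (lebesgue_on Q)"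
    and u: "(\<lambda>n. LINT x|lebesgue_on Q. (u n x - u' x)\<^sup>2) \<longlonglongrightarrow> 0"
    and w: "(\<lambda>n. LINT x|lebesgue_on Q. (w n x - w' x)\<^sup>2) \<longlonglongrightarrow> 0"
  shows "has_weak_deriv Q \<beta> u' w'"
proof -
  have "(LINT x|lebesgue_on Q. u' x * foldr dir_deriv bs \<phi> x) =
      (- 1) ^ size \<beta> * (LINT x|lebesgue_on Q. w' x * \<phi> x)"
    if \<phi>: "test_function Q \<phi>" and bs: "mset bs = \<beta>" for \<phi> bs
  proof (rule LIMSEQ_unique)
    have L2n: "u n \<in> L2 (lebesgue_on Q)" "w n \<in> L2 (lebesgue_on Q)" for n
      using d[of n] by (auto dest: has_weak_deriv_L2)
    have "set bs \<subseteq> Basis" using bs \<beta> by auto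
    note \<psi> = test_function_deriv_L2[OF Q \<phi> this] test_function_L2[OF Q \<phi>]
    show "(\<lambda>n. LINT x|lebesgue_on Q. u n x * foldr dir_deriv bs \<phi> x)
        \<longlonglongrightarrow> (LINT x|lebesgue_on Q. u' x * foldr dir_deriv bs \<phi> x)"
      by (rule L2_tendsto_inner[OF L2n(1) L2(1) \<psi>(1) u])
    have "(LINT x|lebesgue_on Q. u n x * foldr dir_deriv bs \<phi> x) =
        (- 1) ^ size \<beta> * (LINT x|lebesgue_on Q. w n x * \<phi> x)" for n
      using has_weak_derivD[OF d[of n, folded bs] \<phi>] bs by auto
    then show "(\<lambda>n. LINT x|lebesgue_on Q. u n x * foldr dir_deriv bs \<phi> x)
        \<longlonglongrightarrow> (- 1) ^ size \<beta> * (LINT x|lebesgue_on Q. w' x * \<phi> x)"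
      using tendsto_mult_left[OF L2_tendsto_inner[OF L2n(2) L2(2) \<psi>(2) w]] by simp
  qed
  then show ?thesis using L2 by (auto simp: has_weak_deriv_def)
qed

section \<open>Sobolev norms and completeness\<close>

lemma finite_multi_indices: "finite (multi_indices k :: 'a::euclidean_space multiset set)"
proof (rule finite_subset)
  show "multi_indices k \<subseteq> mset ` {bs :: 'a list. set bs \<subseteq> Basis \<and> length bs \<le> k}"
  proof
    fix \<beta> :: "'a multiset" assume \<beta>: "\<beta> \<in> multi_indices k"
    obtain bs where bs: "mset bs = \<beta>" using ex_mset by blast
    have "set bs \<subseteq> Basis \<and> length bs \<le> k"
      using \<beta> bs[symmetric] by (simp add: multi_indices_def)
    then show "\<beta> \<in> mset ` {bs. set bs \<subseteq> Basis \<and> length bs \<le> k}"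
      using bs by blast
  qed
  show "finite (mset ` {bs :: 'a list. set bs \<subseteq> Basis \<and> length bs \<le> k})"
    by (intro finite_imageI finite_lists_length_le) simp
qed

lemma empty_multi_index: "{#} \<in> multi_indices k"
  by (simp add: multi_indices_def)

lemma has_weak_deriv_weak_deriv:
  assumes "u \<in> sobolev k Q" "\<beta> \<in> multi_indices k"
  shows "has_weak_deriv Q \<beta> u (weak_deriv Q \<beta> u)"
proof -
  have "\<exists>w. has_weak_deriv Q \<beta> u w" using assms by (simp add: sobolev_def)
  then show ?thesis unfolding weak_deriv_def by (rule someI_ex)
qed

lemma sobolev_imp_L2:
  assumes "u \<in> sobolev k Q"
  shows "u \<in> L2 (lebesgue_on Q)"
  by (rule has_weak_deriv_L2(1)[OF has_weak_deriv_weak_deriv[OF assms empty_multi_index]])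

lemma weak_deriv_L2:
  assumes "u \<in> sobolev k Q" "\<beta> \<in> multi_indices k"
  shows "weak_deriv Q \<beta> u \<in> L2 (lebesgue_on Q)"
  by (rule has_weak_deriv_L2(2)[OF has_weak_deriv_weak_deriv[OF assms]])

text \<open>Uniqueness turns the arbitrary choice in \<open>weak_deriv\<close> into a usable value; all further
  computations with \<open>weak_deriv\<close> go through this fact.\<close>

lemma weak_deriv_eqI:
  assumes "open Q" "bounded Q" "has_weak_deriv Q \<beta> u w"
  shows "AE x in lebesgue_on Q. weak_deriv Q \<beta> u x = w x"
proof (rule has_weak_deriv_unique[OF assms(1,2) _ assms(3)])
  show "has_weak_deriv Q \<beta> u (weak_deriv Q \<beta> u)"
    unfolding weak_deriv_def by (rule someI[of "has_weak_deriv Q \<beta> u", OF assms(3)])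
qed

lemma weak_deriv_empty:
  assumes "open Q" "bounded Q" "u \<in> L2 (lebesgue_on Q)"
  shows "AE x in lebesgue_on Q. weak_deriv Q {#} u x = u x"
  by (rule weak_deriv_eqI[OF assms(1,2) has_weak_deriv_empty[OF assms(3)]])

lemma multi_indices_Basis: "\<beta> \<in> multi_indices k \<Longrightarrow> set_mset \<beta> \<subseteq> Basis"
  by (simp add: multi_indices_def)

lemma sobolev_lincomb:
  assumes "open Q" "bounded Q" "u \<in> sobolev k Q" "v \<in> sobolev k Q"
  shows "(\<lambda>x. c * u x + d * v x) \<in> sobolev k Q"
  unfolding sobolev_def
  using has_weak_deriv_lincomb[OF assms(1,2) multi_indices_Basis
      has_weak_deriv_weak_deriv[OF assms(3)] has_weak_deriv_weak_deriv[OF assms(4)]]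
  by blast

lemma sobolev_mono: "j \<le> k \<Longrightarrow> u \<in> sobolev k Q \<Longrightarrow> u \<in> sobolev j Q"
  unfolding sobolev_def multi_indices_def by fastforce

lemma weak_deriv_lincomb:
  assumes "open Q" "bounded Q" "u \<in> sobolev k Q" "v \<in> sobolev k Q" "\<beta> \<in> multi_indices k"
  shows "AE x in lebesgue_on Q. weak_deriv Q \<beta> (\<lambda>x. c * u x + d * v x) x =
    c * weak_deriv Q \<beta> u x + d * weak_deriv Q \<beta> v x"
  by (rule weak_deriv_eqI[OF assms(1,2) has_weak_deriv_lincomb[OF assms(1,2) multi_indices_Basis[OF assms(5)]
          has_weak_deriv_weak_deriv[OF assms(3,5)] has_weak_deriv_weak_deriv[OF assms(4,5)]]])

lemma sobolev_norm_power2: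
  "(sobolev_norm k Q u)\<^sup>2 = (\<Sum>\<beta>\<in>multi_indices k. LINT x|lebesgue_on Q. (weak_deriv Q \<beta> u x)\<^sup>2)"
  unfolding sobolev_norm_def by (intro real_sqrt_pow2 sum_nonneg integral_nonneg_AE) simp

lemma sobolev_norm_nonneg: "0 \<le> sobolev_norm k Q u"
  unfolding sobolev_norm_def by (intro real_sqrt_ge_zero sum_nonneg integral_nonneg_AE) simp

lemma sobolev_norm_mono: "j \<le> k \<Longrightarrow> sobolev_norm j Q u \<le> sobolev_norm k Q u"
  unfolding sobolev_norm_def
  by (intro real_sqrt_le_mono sum_mono2 finite_multi_indices integral_nonneg_AE)
     (auto simp: multi_indices_def)

lemma weak_deriv_le_sobolev_norm:
  assumes "\<beta> \<in> multi_indices k"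
  shows "(LINT x|lebesgue_on Q. (weak_deriv Q \<beta> u x)\<^sup>2) \<le> (sobolev_norm k Q u)\<^sup>2"
  unfolding sobolev_norm_power2
  by (rule member_le_sum[OF assms _ finite_multi_indices]) (auto intro: integral_nonneg_AE)

text \<open>Norms of linear combinations are computed from the weak derivatives of the summands; the
  algebra of the norm then reduces to pointwise algebra under the integral.\<close>

lemma sobolev_norm_lincomb:
  assumes Q: "open Q" "bounded Q" and uv: "u \<in> sobolev k Q" "v \<in> sobolev k Q"
  shows "(sobolev_norm k Q (\<lambda>x. c * u x + d * v x))\<^sup>2 =
    (\<Sum>\<beta>\<in>multi_indices k. LINT x|lebesgue_on Q. (c * weak_deriv Q \<beta> u x + d * weak_deriv Q \<beta> v x)\<^sup>2)"
  unfolding sobolev_norm_power2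
proof (rule sum.cong[OF refl])
  fix \<beta> :: "'a multiset" assume \<beta>: "\<beta> \<in> multi_indices k"
  show "(LINT x|lebesgue_on Q. (weak_deriv Q \<beta> (\<lambda>x. c * u x + d * v x) x)\<^sup>2) =
    (LINT x|lebesgue_on Q. (c * weak_deriv Q \<beta> u x + d * weak_deriv Q \<beta> v x)\<^sup>2)"
  proof (rule integral_cong_AE)
    show "AE x in lebesgue_on Q. (weak_deriv Q \<beta> (\<lambda>x. c * u x + d * v x) x)\<^sup>2 =
      (c * weak_deriv Q \<beta> u x + d * weak_deriv Q \<beta> v x)\<^sup>2"
      using weak_deriv_lincomb[OF Q uv \<beta>, of c d] by eventually_elim simp
  qed (intro borel_measurable_power L2_measurable L2_lincomb weak_deriv_L2[OF _ \<beta>]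
      sobolev_lincomb Q uv)+
qed

lemma sobolev_norm_scale:
  assumes "open Q" "bounded Q" and u: "u \<in> sobolev k Q"
  shows "sobolev_norm k Q (\<lambda>x. c * u x) = \<bar>c\<bar> * sobolev_norm k Q u"
proof -
  have "(sobolev_norm k Q (\<lambda>x. c * u x))\<^sup>2 = (\<bar>c\<bar> * sobolev_norm k Q u)\<^sup>2"
    using sobolev_norm_lincomb[OF assms u, of c 0]
    by (simp add: power_mult_distrib sobolev_norm_power2 sum_distrib_left)
  then show ?thesis
    by (rule power2_eq_imp_eq) (simp_all add: sobolev_norm_nonneg)
qed

lemma sobolev_norm_parallelogram:
  assumes Q: "open Q" "bounded Q" and uv: "u \<in> sobolev k Q" "v \<in> sobolev k Q"
  shows "(sobolev_norm k Q (\<lambda>x. (u x + v x) / 2))\<^sup>2 + (sobolev_norm k Q (\<lambda>x. u x - v x))\<^sup>2 / 4 =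
    ((sobolev_norm k Q u)\<^sup>2 + (sobolev_norm k Q v)\<^sup>2) / 2"
proof -
  let ?D = "weak_deriv Q"
  have m: "(\<lambda>x. (u x + v x) / 2) = (\<lambda>x. 1/2 * u x + 1/2 * v x)"
    and d: "(\<lambda>x. u x - v x) = (\<lambda>x. 1 * u x + (-1) * v x)" by (auto simp: field_simps)
  have "(LINT x|lebesgue_on Q. (1/2 * ?D \<beta> u x + 1/2 * ?D \<beta> v x)\<^sup>2) +
      (LINT x|lebesgue_on Q. (1 * ?D \<beta> u x + (-1) * ?D \<beta> v x)\<^sup>2) / 4 =
      ((LINT x|lebesgue_on Q. (?D \<beta> u x)\<^sup>2) + (LINT x|lebesgue_on Q. (?D \<beta> v x)\<^sup>2)) / 2"
    if \<beta>: "\<beta> \<in> multi_indices k" for \<beta>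
  proof -
    note L2 = weak_deriv_L2[OF uv(1) \<beta>] weak_deriv_L2[OF uv(2) \<beta>]
    have "(LINT x|lebesgue_on Q. (1/2 * ?D \<beta> u x + 1/2 * ?D \<beta> v x)\<^sup>2) +
      (LINT x|lebesgue_on Q. (1 * ?D \<beta> u x + (-1) * ?D \<beta> v x)\<^sup>2) / 4 =
      (LINT x|lebesgue_on Q. (1/2 * ?D \<beta> u x + 1/2 * ?D \<beta> v x)\<^sup>2 + (1 * ?D \<beta> u x + (-1) * ?D \<beta> v x)\<^sup>2 / 4)"
      by (subst Bochner_Integration.integral_add)
         (intro L2_integrable_power2 L2_lincomb L2 integrable_divide_zero impI | simp)+
    also have "\<dots> = (LINT x|lebesgue_on Q. ((?D \<beta> u x)\<^sup>2 + (?D \<beta> v x)\<^sup>2) / 2)"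
      by (intro Bochner_Integration.integral_cong) (auto simp: power2_eq_square field_simps)
    also have "\<dots> = ((LINT x|lebesgue_on Q. (?D \<beta> u x)\<^sup>2) + (LINT x|lebesgue_on Q. (?D \<beta> v x)\<^sup>2)) / 2"
      using L2_integrable_power2[OF L2(1)] L2_integrable_power2[OF L2(2)] by simp
    finally show ?thesis .
  qed
  from sum.cong[OF refl this, of "multi_indices k"] show ?thesis
    unfolding m d sobolev_norm_lincomb[OF Q uv] sobolev_norm_power2[of k Q u] sobolev_norm_power2[of k Q v]
    by (simp only: sum.distrib flip: sum_divide_distrib)
qed

text \<open>A substitute for the triangle inequality in terms of squared norms, which are the quantities
  that occur in the functional.\<close>

lemma sobolev_norm_add_le:
  assumes Q: "open Q" "bounded Q" and uv: "u \<in> sobolev k Q" "v \<in> sobolev k Q" and e: "e > 0"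
  shows "(sobolev_norm k Q (\<lambda>x. u x + v x))\<^sup>2 \<le>
    (1 + e) * (sobolev_norm k Q u)\<^sup>2 + (1 + 1 / e) * (sobolev_norm k Q v)\<^sup>2"
proof -
  let ?D = "weak_deriv Q"
  have "(sobolev_norm k Q (\<lambda>x. u x + v x))\<^sup>2 =
      (\<Sum>\<beta>\<in>multi_indices k. LINT x|lebesgue_on Q. (1 * ?D \<beta> u x + 1 * ?D \<beta> v x)\<^sup>2)"
    using sobolev_norm_lincomb[OF Q uv, of 1 1] by simp
  also have "\<dots> \<le> (\<Sum>\<beta>\<in>multi_indices k. (1 + e) * (LINT x|lebesgue_on Q. (?D \<beta> u x)\<^sup>2) +
      (1 + 1 / e) * (LINT x|lebesgue_on Q. (?D \<beta> v x)\<^sup>2))"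
  proof (rule sum_mono)
    fix \<beta> :: "'a multiset" assume \<beta>: "\<beta> \<in> multi_indices k"
    note L2 = weak_deriv_L2[OF uv(1) \<beta>] weak_deriv_L2[OF uv(2) \<beta>]
    note i = L2_integrable_power2[OF L2(1)] L2_integrable_power2[OF L2(2)]
    have "(LINT x|lebesgue_on Q. (1 * ?D \<beta> u x + 1 * ?D \<beta> v x)\<^sup>2) \<le>
        (LINT x|lebesgue_on Q. (1 + e) * (?D \<beta> u x)\<^sup>2 + (1 + 1 / e) * (?D \<beta> v x)\<^sup>2)"
      by (rule integral_mono[OF L2_integrable_power2[OF L2_lincomb[OF L2]]])
         (use i Young_power2_sum[OF e] in auto)
    also have "\<dots> = (1 + e) * (LINT x|lebesgue_on Q. (?D \<beta> u x)\<^sup>2) +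
        (1 + 1 / e) * (LINT x|lebesgue_on Q. (?D \<beta> v x)\<^sup>2)"
      using i by simp
    finally show "(LINT x|lebesgue_on Q. (1 * ?D \<beta> u x + 1 * ?D \<beta> v x)\<^sup>2) \<le> \<dots>" .
  qed
  also have "\<dots> = (1 + e) * (sobolev_norm k Q u)\<^sup>2 + (1 + 1 / e) * (sobolev_norm k Q v)\<^sup>2"
    by (simp add: sobolev_norm_power2 sum.distrib sum_distrib_left)
  finally show ?thesis .
qed

lemma sobolev_diff:
  assumes "open Q" "bounded Q" "u \<in> sobolev k Q" "v \<in> sobolev k Q"
  shows "(\<lambda>x. u x - v x) \<in> sobolev k Q"
  using sobolev_lincomb[OF assms, of 1 "-1"] by simp

text \<open>Each weak derivative of the sequence is a Cauchy sequence in \<open>L\<^sub>2\<close>. The limit of the functions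
  themselves (order zero) has the limits of the derivatives as its weak derivatives.\<close>

lemma sobolev_complete:
  assumes Q: "open Q" "bounded Q" and u: "\<And>n. u n \<in> sobolev k Q"
    and Cauchy: "\<And>e. e > 0 \<Longrightarrow> \<exists>N. \<forall>i\<ge>N. \<forall>j\<ge>N. (sobolev_norm k Q (\<lambda>x. u i x - u j x))\<^sup>2 < e"
  shows "\<exists>v\<in>sobolev k Q. (\<lambda>n. sobolev_norm k Q (\<lambda>x. u n x - v x)) \<longlonglongrightarrow> 0"
proof -
  let ?D = "weak_deriv Q"
  have "\<exists>W. W \<in> L2 (lebesgue_on Q) \<and> (\<lambda>n. LINT x|lebesgue_on Q. (?D \<beta> (u n) x - W x)\<^sup>2) \<longlonglongrightarrow> 0"
    if \<beta>: "\<beta> \<in> multi_indices k" for \<beta>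
  proof -
    have "\<exists>N. \<forall>i\<ge>N. \<forall>j\<ge>N. (LINT x|lebesgue_on Q. (?D \<beta> (u i) x - ?D \<beta> (u j) x)\<^sup>2) < e" if e: "e > 0" for e
    proof -
      have "(LINT x|lebesgue_on Q. (?D \<beta> (u i) x - ?D \<beta> (u j) x)\<^sup>2) \<le>
          (sobolev_norm k Q (\<lambda>x. u i x - u j x))\<^sup>2" for i j
        using sobolev_norm_lincomb[OF Q u[of i] u[of j], of 1 "-1"]
          member_le_sum[OF \<beta> _ finite_multi_indices,
            of "\<lambda>\<beta>. LINT x|lebesgue_on Q. (?D \<beta> (u i) x - ?D \<beta> (u j) x)\<^sup>2"]
        by simp
      then show ?thesis using Cauchy[OF e] by (meson le_less_trans)
    qed
    then show ?thesis
      using L2_complete[OF finite_measure_lebesgue_on_open[OF Q], of "\<lambda>n. ?D \<beta> (u n)"]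
        weak_deriv_L2[OF u \<beta>] by blast
  qed
  then have "\<forall>\<beta>\<in>multi_indices k. \<exists>W. W \<in> L2 (lebesgue_on Q) \<and>
      (\<lambda>n. LINT x|lebesgue_on Q. (?D \<beta> (u n) x - W x)\<^sup>2) \<longlonglongrightarrow> 0" by blast
  from bchoice[OF this] obtain W where W': "\<forall>\<beta>\<in>multi_indices k. W \<beta> \<in> L2 (lebesgue_on Q) \<and>
      (\<lambda>n. LINT x|lebesgue_on Q. (?D \<beta> (u n) x - W \<beta> x)\<^sup>2) \<longlonglongrightarrow> 0" ..
  then have W: "\<And>\<beta>. \<beta> \<in> multi_indices k \<Longrightarrow> W \<beta> \<in> L2 (lebesgue_on Q)"
    "\<And>\<beta>. \<beta> \<in> multi_indices k \<Longrightarrow> (\<lambda>n. LINT x|lebesgue_on Q. (?D \<beta> (u n) x - W \<beta> x)\<^sup>2) \<longlonglongrightarrow> 0"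
    by blast+
  \<comment> \<open>The entry at the empty multi-index is the limit of the functions themselves.\<close>
  define v where "v = W {#}"
  have v: "v \<in> L2 (lebesgue_on Q)" using W(1)[OF empty_multi_index] by (simp add: v_def)
  have "(LINT x|lebesgue_on Q. (u n x - v x)\<^sup>2) = (LINT x|lebesgue_on Q. (?D {#} (u n) x - W {#} x)\<^sup>2)" for n
  proof (rule integral_cong_AE)
    show "AE x in lebesgue_on Q. (u n x - v x)\<^sup>2 = (?D {#} (u n) x - W {#} x)\<^sup>2"
      using weak_deriv_empty[OF Q sobolev_imp_L2[OF u[of n]]] by eventually_elim (simp add: v_def)
  qed (intro borel_measurable_power borel_measurable_diff L2_measurable v sobolev_imp_L2[OF u]
      weak_deriv_L2[OF u empty_multi_index] W(1)[OF empty_multi_index])+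
  then have lim: "(\<lambda>n. LINT x|lebesgue_on Q. (u n x - v x)\<^sup>2) \<longlonglongrightarrow> 0"
    using W(2)[OF empty_multi_index] by simp
  have hv: "has_weak_deriv Q \<beta> v (W \<beta>)" if \<beta>: "\<beta> \<in> multi_indices k" for \<beta>
    by (rule has_weak_deriv_limit[OF Q multi_indices_Basis[OF \<beta>] has_weak_deriv_weak_deriv[OF u \<beta>]
          v W(1)[OF \<beta>] lim W(2)[OF \<beta>]])
  then have vs: "v \<in> sobolev k Q" by (auto simp: sobolev_def)
  have "(sobolev_norm k Q (\<lambda>x. u n x - v x))\<^sup>2 =
      (\<Sum>\<beta>\<in>multi_indices k. LINT x|lebesgue_on Q. (?D \<beta> (u n) x - W \<beta> x)\<^sup>2)" for n
  proof -
    have "(LINT x|lebesgue_on Q. (?D \<beta> (u n) x - ?D \<beta> v x)\<^sup>2) =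
        (LINT x|lebesgue_on Q. (?D \<beta> (u n) x - W \<beta> x)\<^sup>2)" if \<beta>: "\<beta> \<in> multi_indices k" for \<beta>
    proof (rule integral_cong_AE)
      show "AE x in lebesgue_on Q. (?D \<beta> (u n) x - ?D \<beta> v x)\<^sup>2 = (?D \<beta> (u n) x - W \<beta> x)\<^sup>2"
        using weak_deriv_eqI[OF Q hv[OF \<beta>]] by eventually_elim simp
    qed (intro borel_measurable_power borel_measurable_diff L2_measurable
        weak_deriv_L2[OF u \<beta>] weak_deriv_L2[OF vs \<beta>] W(1)[OF \<beta>])+
    then show ?thesis using sobolev_norm_lincomb[OF Q u[of n] vs, of 1 "-1"] by simp
  qed
  moreover have "(\<lambda>n. \<Sum>\<beta>\<in>multi_indices k. LINT x|lebesgue_on Q. (?D \<beta> (u n) x - W \<beta> x)\<^sup>2)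
      \<longlonglongrightarrow> (\<Sum>\<beta>\<in>(multi_indices k :: 'a multiset set). 0)"
    by (intro tendsto_sum W(2))
  ultimately have "(\<lambda>n. (sobolev_norm k Q (\<lambda>x. u n x - v x))\<^sup>2) \<longlonglongrightarrow> 0"
    by (simp only: sum.neutral_const)
  then have "(\<lambda>n. sobolev_norm k Q (\<lambda>x. u n x - v x)) \<longlonglongrightarrow> 0" by simp
  then show ?thesis using vs by blast
qed

section \<open>Functions with zero trace\<close>

lemma has_weak_deriv_0: "has_weak_deriv Q \<beta> (\<lambda>_. 0) (\<lambda>_. 0)"
  by (simp add: has_weak_deriv_def L2_def)

lemma sobolev_0: "(\<lambda>_. 0) \<in> sobolev k Q"
  unfolding sobolev_def using has_weak_deriv_0 by blast

lemma sobolev_norm_0: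
  assumes "open Q" "bounded Q"
  shows "sobolev_norm k Q (\<lambda>_. 0) = 0"
  using sobolev_norm_scale[OF assms sobolev_0[of k Q], of 0] by simp

lemma C1_closure_lincomb:
  assumes "f \<in> C1_closure Q" "g \<in> C1_closure Q"
  shows "(\<lambda>x. c * f x + d * g x) \<in> C1_closure Q"
proof -
  obtain F where F: "continuous_on (closure Q) F" "\<And>x. x \<in> Q \<Longrightarrow> (f has_derivative (\<lambda>h. F x \<bullet> h)) (at x)"
    using assms(1) by (auto simp: C1_closure_def)
  obtain G where G: "continuous_on (closure Q) G" "\<And>x. x \<in> Q \<Longrightarrow> (g has_derivative (\<lambda>h. G x \<bullet> h)) (at x)"
    using assms(2) by (auto simp: C1_closure_def)
  have fg: "continuous_on (closure Q) f" "continuous_on (closure Q) g"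
    using assms by (auto simp: C1_closure_def)
  have "continuous_on (closure Q) (\<lambda>x. c * f x + d * g x)"
    by (intro continuous_intros fg)
  moreover have "continuous_on (closure Q) (\<lambda>x. c *\<^sub>R F x + d *\<^sub>R G x)"
    by (intro continuous_intros F(1) G(1))
  moreover have "((\<lambda>x. c * f x + d * g x) has_derivative (\<lambda>h. (c *\<^sub>R F x + d *\<^sub>R G x) \<bullet> h)) (at x)"
    if "x \<in> Q" for x
    using has_derivative_add[OF has_derivative_mult_right[OF F(2)[OF that], of c]
        has_derivative_mult_right[OF G(2)[OF that], of d]]
    by (simp add: inner_add_left)
  ultimately show ?thesis unfolding C1_closure_def by blast
qed

lemma C1_closure_0: "(\<lambda>_. 0) \<in> C1_closure (Q :: 'a::euclidean_space set)"
proof -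
  have "((\<lambda>_. 0) has_derivative (\<lambda>h. 0 \<bullet> h)) (at x)" for x :: 'a
    by (simp only: inner_zero_left has_derivative_const)
  then show ?thesis unfolding C1_closure_def
    using continuous_on_const[of "closure Q" "0 :: real"] continuous_on_const[of "closure Q" "0 :: 'a"] by blast
qed

text \<open>The surface measure is defined on the Borel sets, so continuity on the closure gives
  measurability on any part of it.\<close>

lemma C1_closure_measurable_surface:
  assumes "f \<in> C1_closure Q" "\<Gamma> \<subseteq> closure Q"
  shows "f \<in> borel_measurable (restrict_space surface_measure \<Gamma>)"
proof -
  have "sets (surface_measure :: 'a measure) = sets borel"
    unfolding surface_measure_def using sets.sigma_sets_eq[of "borel :: 'a measure"]
    by (simp add: sets_measure_of)
  then have s: "sets (restrict_space surface_measure \<Gamma>) = sets (restrict_space borel \<Gamma>)"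
    by (rule sets_restrict_space_cong)
  have "continuous_on \<Gamma> f"
    using assms by (auto simp: C1_closure_def intro: continuous_on_subset)
  then show ?thesis
    unfolding measurable_cong_sets[OF s refl] by (rule borel_measurable_continuous_on_restrict)
qed

text \<open>The same linear combination of the approximating sequences approximates. Measurability on the
  boundary part is what allows the nonnegative integral of the upper bound to be split, and it
  comes from continuity up to the closure.\<close>

lemma has_trace_0_lincomb:
  assumes Q: "open Q" "bounded Q" and \<Gamma>: "\<Gamma> \<subseteq> closure Q"
    and u: "has_trace Q \<Gamma> u (\<lambda>_. 0)" and v: "has_trace Q \<Gamma> v (\<lambda>_. 0)"
  shows "has_trace Q \<Gamma> (\<lambda>x. c * u x + d * v x) (\<lambda>_. 0)"
proof -
  let ?S = "restrict_space surface_measure \<Gamma>"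
  obtain U where U: "\<And>k. U k \<in> C1_closure Q" "\<And>k. U k \<in> sobolev 1 Q"
    "(\<lambda>k. sobolev_norm 1 Q (\<lambda>x. U k x - u x)) \<longlonglongrightarrow> 0"
    "(\<lambda>k. \<integral>\<^sup>+x. ennreal ((U k x)\<^sup>2) \<partial>?S) \<longlonglongrightarrow> 0"
    using u unfolding has_trace_def by auto
  obtain V where V: "\<And>k. V k \<in> C1_closure Q" "\<And>k. V k \<in> sobolev 1 Q"
    "(\<lambda>k. sobolev_norm 1 Q (\<lambda>x. V k x - v x)) \<longlonglongrightarrow> 0"
    "(\<lambda>k. \<integral>\<^sup>+x. ennreal ((V k x)\<^sup>2) \<partial>?S) \<longlonglongrightarrow> 0"
    using v unfolding has_trace_def by auto
  have us: "u \<in> sobolev 1 Q" and vs: "v \<in> sobolev 1 Q"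
    using u v unfolding has_trace_def by auto
  let ?W = "\<lambda>k x. c * U k x + d * V k x"
  have "(\<lambda>k. sobolev_norm 1 Q (\<lambda>x. ?W k x - (c * u x + d * v x))) \<longlonglongrightarrow> 0"
  proof -
    let ?nu = "\<lambda>k. sobolev_norm 1 Q (\<lambda>x. U k x - u x)" and ?nv = "\<lambda>k. sobolev_norm 1 Q (\<lambda>x. V k x - v x)"
    have le: "(sobolev_norm 1 Q (\<lambda>x. ?W k x - (c * u x + d * v x)))\<^sup>2 \<le>
        2 * (\<bar>c\<bar> * ?nu k)\<^sup>2 + 2 * (\<bar>d\<bar> * ?nv k)\<^sup>2" for k
    proof -
      have du: "(\<lambda>x. U k x - u x) \<in> sobolev 1 Q" and dv: "(\<lambda>x. V k x - v x) \<in> sobolev 1 Q"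
        by (intro sobolev_diff Q U(2) V(2) us vs)+
      have cu: "(\<lambda>x. c * (U k x - u x)) \<in> sobolev 1 Q" and cv: "(\<lambda>x. d * (V k x - v x)) \<in> sobolev 1 Q"
        using sobolev_lincomb[OF Q du du, of c 0] sobolev_lincomb[OF Q dv dv, of d 0] by simp_all
      have "(\<lambda>x. ?W k x - (c * u x + d * v x)) = (\<lambda>x. c * (U k x - u x) + d * (V k x - v x))"
        by (simp add: algebra_simps)
      then show ?thesis
        using sobolev_norm_add_le[OF Q cu cv, of 1,
            unfolded sobolev_norm_scale[OF Q du] sobolev_norm_scale[OF Q dv]]
        by simp
    qed
    have "(\<lambda>k. 2 * (\<bar>c\<bar> * ?nu k)\<^sup>2 + 2 * (\<bar>d\<bar> * ?nv k)\<^sup>2) \<longlonglongrightarrow> 2 * (\<bar>c\<bar> * 0)\<^sup>2 + 2 * (\<bar>d\<bar> * 0)\<^sup>2"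
      by (intro tendsto_intros U(3) V(3))
    then have lim: "(\<lambda>k. 2 * (\<bar>c\<bar> * ?nu k)\<^sup>2 + 2 * (\<bar>d\<bar> * ?nv k)\<^sup>2) \<longlonglongrightarrow> 0" by simp
    have "(\<lambda>k. (sobolev_norm 1 Q (\<lambda>x. ?W k x - (c * u x + d * v x)))\<^sup>2) \<longlonglongrightarrow> 0"
      by (rule tendsto_sandwich[OF _ _ tendsto_const lim])
         (simp, rule always_eventually, rule allI, rule le)
    then show ?thesis by simp
  qed
  moreover have "(\<lambda>k. \<integral>\<^sup>+x. ennreal ((?W k x)\<^sup>2) \<partial>?S) \<longlonglongrightarrow> 0"
  proof (rule tendsto_sandwich[OF _ _ tendsto_const])
    let ?b = "\<lambda>k. ennreal (2 * c\<^sup>2) * (\<integral>\<^sup>+x. ennreal ((U k x)\<^sup>2) \<partial>?S) +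
        ennreal (2 * d\<^sup>2) * (\<integral>\<^sup>+x. ennreal ((V k x)\<^sup>2) \<partial>?S)"
    have "?b \<longlonglongrightarrow> ennreal (2 * c\<^sup>2) * 0 + ennreal (2 * d\<^sup>2) * 0"
      by (intro tendsto_add ennreal_tendsto_cmult U(4) V(4)) simp_all
    then show "?b \<longlonglongrightarrow> 0" by simp
    have "(\<integral>\<^sup>+x. ennreal ((?W k x)\<^sup>2) \<partial>?S) \<le> ?b k" for k
    proof -
      have m: "U k \<in> borel_measurable ?S" "V k \<in> borel_measurable ?S"
        using C1_closure_measurable_surface[OF U(1) \<Gamma>] C1_closure_measurable_surface[OF V(1) \<Gamma>] by auto
      have pt: "ennreal ((?W k x)\<^sup>2) \<le> ennreal (2 * c\<^sup>2) * ennreal ((U k x)\<^sup>2) + ennreal (2 * d\<^sup>2) * ennreal ((V k x)\<^sup>2)" for x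
      proof -
        have "(?W k x)\<^sup>2 \<le> (2 * c\<^sup>2) * (U k x)\<^sup>2 + (2 * d\<^sup>2) * (V k x)\<^sup>2"
          using Young_power2_sum[of 1 "c * U k x" "d * V k x"] by (simp add: power_mult_distrib)
        then have "ennreal ((?W k x)\<^sup>2) \<le> ennreal ((2 * c\<^sup>2) * (U k x)\<^sup>2 + (2 * d\<^sup>2) * (V k x)\<^sup>2)"
          by (rule ennreal_leI)
        also have "\<dots> = ennreal (2 * c\<^sup>2) * ennreal ((U k x)\<^sup>2) + ennreal (2 * d\<^sup>2) * ennreal ((V k x)\<^sup>2)"
          by (simp add: ennreal_plus ennreal_mult)
        finally show ?thesis .
      qed
      have "(\<integral>\<^sup>+x. ennreal ((?W k x)\<^sup>2) \<partial>?S) \<le>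
        (\<integral>\<^sup>+x. ennreal (2 * c\<^sup>2) * ennreal ((U k x)\<^sup>2) + ennreal (2 * d\<^sup>2) * ennreal ((V k x)\<^sup>2) \<partial>?S)"
        by (intro nn_integral_mono pt)
      also have "\<dots> = ?b k"
        using m by (subst nn_integral_add) (simp_all add: nn_integral_cmult)
      finally show ?thesis .
    qed
    then show "\<forall>\<^sub>F k in sequentially. (\<integral>\<^sup>+x. ennreal ((?W k x)\<^sup>2) \<partial>?S) \<le> ?b k" by simp
  qed simp
  moreover have "?W k \<in> C1_closure Q \<inter> sobolev 1 Q" for k
    using C1_closure_lincomb[OF U(1) V(1)] sobolev_lincomb[OF Q U(2) V(2)] by simp
  ultimately show ?thesis
    unfolding has_trace_def using sobolev_lincomb[OF Q us vs]
    by (auto simp: L2_def intro!: exI[of _ ?W])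
qed

text \<open>A diagonal argument: for each \<open>n\<close> one member of the sequence approximating \<open>u n\<close> is chosen that
  is within \<open>1 / (n + 1)\<close> in both senses.\<close>

lemma has_trace_0_limit:
  assumes Q: "open Q" "bounded Q" and u: "\<And>n. has_trace Q \<Gamma> (u n) (\<lambda>_. 0)"
    and v: "v \<in> sobolev 1 Q" and lim: "(\<lambda>n. sobolev_norm 1 Q (\<lambda>x. u n x - v x)) \<longlonglongrightarrow> 0"
  shows "has_trace Q \<Gamma> v (\<lambda>_. 0)"
proof -
  let ?S = "restrict_space surface_measure \<Gamma>"
  let ?e = "\<lambda>n. inverse (real (Suc n))"
  have us: "u n \<in> sobolev 1 Q" for n using u unfolding has_trace_def by auto
  have "\<exists>W. W \<in> C1_closure Q \<and> W \<in> sobolev 1 Q \<and> sobolev_norm 1 Q (\<lambda>x. W x - u n x) < ?e n \<and>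
      (\<integral>\<^sup>+x. ennreal ((W x)\<^sup>2) \<partial>?S) < ennreal (?e n)" for n
  proof -
    obtain U where U: "\<And>k. U k \<in> C1_closure Q" "\<And>k. U k \<in> sobolev 1 Q"
      "(\<lambda>k. sobolev_norm 1 Q (\<lambda>x. U k x - u n x)) \<longlonglongrightarrow> 0"
      "(\<lambda>k. \<integral>\<^sup>+x. ennreal ((U k x)\<^sup>2) \<partial>?S) \<longlonglongrightarrow> 0"
      using u[of n] unfolding has_trace_def by auto
    have "\<forall>\<^sub>F k in sequentially. sobolev_norm 1 Q (\<lambda>x. U k x - u n x) < ?e n"
      by (rule order_tendstoD(2)[OF U(3)]) simp
    moreover have "\<forall>\<^sub>F k in sequentially. (\<integral>\<^sup>+x. ennreal ((U k x)\<^sup>2) \<partial>?S) < ennreal (?e n)"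
      by (rule order_tendstoD(2)[OF U(4)]) simp
    ultimately have "\<forall>\<^sub>F k in sequentially. sobolev_norm 1 Q (\<lambda>x. U k x - u n x) < ?e n \<and>
        (\<integral>\<^sup>+x. ennreal ((U k x)\<^sup>2) \<partial>?S) < ennreal (?e n)"
      by (rule eventually_conj)
    then obtain k where "sobolev_norm 1 Q (\<lambda>x. U k x - u n x) < ?e n \<and>
        (\<integral>\<^sup>+x. ennreal ((U k x)\<^sup>2) \<partial>?S) < ennreal (?e n)"
      using eventually_happens'[OF sequentially_bot] by blast
    then show ?thesis using U(1,2) by blast
  qed
  then have "\<exists>W. \<forall>n. W n \<in> C1_closure Q \<and> W n \<in> sobolev 1 Q \<and> sobolev_norm 1 Q (\<lambda>x. W n x - u n x) < ?e n \<and>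
      (\<integral>\<^sup>+x. ennreal ((W n x)\<^sup>2) \<partial>?S) < ennreal (?e n)"
    by (intro choice allI)
  then obtain W where W': "\<forall>n. W n \<in> C1_closure Q \<and> W n \<in> sobolev 1 Q \<and> sobolev_norm 1 Q (\<lambda>x. W n x - u n x) < ?e n \<and>
      (\<integral>\<^sup>+x. ennreal ((W n x)\<^sup>2) \<partial>?S) < ennreal (?e n)" ..
  then have W: "\<And>n. W n \<in> C1_closure Q" "\<And>n. W n \<in> sobolev 1 Q"
    "\<And>n. sobolev_norm 1 Q (\<lambda>x. W n x - u n x) < ?e n"
    "\<And>n. (\<integral>\<^sup>+x. ennreal ((W n x)\<^sup>2) \<partial>?S) < ennreal (?e n)"
    by blast+
  have "(\<lambda>n. (sobolev_norm 1 Q (\<lambda>x. W n x - v x))\<^sup>2) \<longlonglongrightarrow> 0"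
  proof (rule tendsto_sandwich[OF _ _ tendsto_const])
    let ?b = "\<lambda>n. 2 * (?e n)\<^sup>2 + 2 * (sobolev_norm 1 Q (\<lambda>x. u n x - v x))\<^sup>2"
    have "?b \<longlonglongrightarrow> 2 * 0\<^sup>2 + 2 * 0\<^sup>2"
      by (intro tendsto_intros lim LIMSEQ_inverse_real_of_nat)
    then show "?b \<longlonglongrightarrow> 0" by simp
    have "(sobolev_norm 1 Q (\<lambda>x. W n x - v x))\<^sup>2 \<le> ?b n" for n
    proof -
      have "(sobolev_norm 1 Q (\<lambda>x. W n x - v x))\<^sup>2 \<le>
          2 * (sobolev_norm 1 Q (\<lambda>x. W n x - u n x))\<^sup>2 + 2 * (sobolev_norm 1 Q (\<lambda>x. u n x - v x))\<^sup>2"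
        using sobolev_norm_add_le[OF Q sobolev_diff[OF Q W(2)[of n] us[of n]] sobolev_diff[OF Q us[of n] v], of 1]
        by simp
      moreover have "(sobolev_norm 1 Q (\<lambda>x. W n x - u n x))\<^sup>2 \<le> (?e n)\<^sup>2"
        using W(3)[of n] sobolev_norm_nonneg by (intro power_mono) auto
      ultimately show ?thesis by linarith
    qed
    then show "\<forall>\<^sub>F n in sequentially. (sobolev_norm 1 Q (\<lambda>x. W n x - v x))\<^sup>2 \<le> ?b n" by simp
  qed simp
  then have 1: "(\<lambda>n. sobolev_norm 1 Q (\<lambda>x. W n x - v x)) \<longlonglongrightarrow> 0" by simp
  have "(\<lambda>n. ennreal (?e n)) \<longlonglongrightarrow> ennreal 0"
    by (intro tendsto_ennrealI LIMSEQ_inverse_real_of_nat)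
  then have e0: "(\<lambda>n. ennreal (?e n)) \<longlonglongrightarrow> 0" by simp
  have 2: "(\<lambda>n. \<integral>\<^sup>+x. ennreal ((W n x)\<^sup>2) \<partial>?S) \<longlonglongrightarrow> 0"
    by (rule tendsto_sandwich[OF _ _ tendsto_const e0])
       (simp, rule always_eventually, rule allI, rule less_imp_le[OF W(4)])
  show ?thesis
    unfolding has_trace_def using 1 2 W(1,2) v
    by (auto simp: L2_def intro!: exI[of _ W])
qed

lemma has_trace_0_0:
  assumes "open Q" "bounded Q"
  shows "has_trace Q \<Gamma> (\<lambda>_. 0) (\<lambda>_. 0)"
  unfolding has_trace_def using assms
  by (auto simp: L2_def sobolev_0 C1_closure_0 sobolev_norm_0 intro!: exI[of _ "\<lambda>_ _. 0"])

section \<open>The space of admissible functions on the cylinder\<close>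

lemma cylinder_open_bounded:
  assumes "bounded_domain \<Omega>"
  shows "open (cylinder \<Omega> T)" "bounded (cylinder \<Omega> T)"
  using assms unfolding bounded_domain_def cylinder_def
  by (auto intro: open_Times bounded_Times)

lemma cylinder_boundary:
  assumes "T > 0"
  shows "frontier \<Omega> \<times> {0<..<T} \<subseteq> closure (cylinder \<Omega> T)" "\<Omega> \<times> {T} \<subseteq> closure (cylinder \<Omega> T)"
  using assms closure_subset[of \<Omega>] unfolding cylinder_def closure_Times frontier_def by auto

lemma H20_0: "bounded_domain \<Omega> \<Longrightarrow> (\<lambda>_. 0) \<in> H20 \<Omega> T"
  unfolding H20_def by (simp add: sobolev_0 has_trace_0_0 cylinder_open_bounded)

lemma H20_midpoint:
  assumes \<Omega>: "bounded_domain \<Omega>" and T: "T > 0" and uv: "u \<in> H20 \<Omega> T" "v \<in> H20 \<Omega> T"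
  shows "(\<lambda>z. (u z + v z) / 2) \<in> H20 \<Omega> T"
proof -
  note Q = cylinder_open_bounded[OF \<Omega>, of T]
  have u: "u \<in> sobolev 2 (cylinder \<Omega> T)" "has_trace (cylinder \<Omega> T) (frontier \<Omega> \<times> {0<..<T}) u (\<lambda>_. 0)"
      "has_trace (cylinder \<Omega> T) (\<Omega> \<times> {T}) u (\<lambda>_. 0)"
    and v: "v \<in> sobolev 2 (cylinder \<Omega> T)" "has_trace (cylinder \<Omega> T) (frontier \<Omega> \<times> {0<..<T}) v (\<lambda>_. 0)"
      "has_trace (cylinder \<Omega> T) (\<Omega> \<times> {T}) v (\<lambda>_. 0)"
    using uv unfolding H20_def by auto
  have "(\<lambda>z. 1/2 * u z + 1/2 * v z) \<in> H20 \<Omega> T"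
    unfolding H20_def
    using sobolev_lincomb[OF Q u(1) v(1)] has_trace_0_lincomb[OF Q cylinder_boundary(1)[OF T] u(2) v(2)]
      has_trace_0_lincomb[OF Q cylinder_boundary(2)[OF T] u(3) v(3)] by blast
  then show ?thesis by (simp add: add_divide_distrib)
qed

text \<open>Convergence in \<open>H\<^sup>2\<close> implies convergence in \<open>H\<^sup>1\<close>, for which the trace conditions are closed.\<close>

lemma H20_limit:
  assumes \<Omega>: "bounded_domain \<Omega>" and u: "\<And>n. u n \<in> H20 \<Omega> T"
    and v: "v \<in> sobolev 2 (cylinder \<Omega> T)"
    and lim: "(\<lambda>n. sobolev_norm 2 (cylinder \<Omega> T) (\<lambda>z. u n z - v z)) \<longlonglongrightarrow> 0"
  shows "v \<in> H20 \<Omega> T"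
proof -
  note Q = cylinder_open_bounded[OF \<Omega>, of T]
  have v1: "v \<in> sobolev 1 (cylinder \<Omega> T)" using v by (rule sobolev_mono[rotated]) simp
  have lim1: "(\<lambda>n. sobolev_norm 1 (cylinder \<Omega> T) (\<lambda>z. u n z - v z)) \<longlonglongrightarrow> 0"
    by (rule tendsto_sandwich[OF _ _ tendsto_const lim])
       (simp_all add: sobolev_norm_nonneg sobolev_norm_mono)
  have "has_trace (cylinder \<Omega> T) (frontier \<Omega> \<times> {0<..<T}) (u n) (\<lambda>_. 0)"
    "has_trace (cylinder \<Omega> T) (\<Omega> \<times> {T}) (u n) (\<lambda>_. 0)" for n
    using u[of n] unfolding H20_def by auto
  from has_trace_0_limit[OF Q this(1) v1 lim1] has_trace_0_limit[OF Q this(2) v1 lim1]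
  show ?thesis using v unfolding H20_def by blast
qed

section \<open>Regularized least squares for linear differential operators\<close>

text \<open>The general linear differential operator of order at most \<open>m\<close>, with coefficient \<open>k \<beta>\<close> at the
  derivative with multi-index \<open>\<beta>\<close>.\<close>

definition diff_op ::
    "nat \<Rightarrow> 'a::euclidean_space set \<Rightarrow> ('a multiset \<Rightarrow> 'a \<Rightarrow> real) \<Rightarrow> ('a \<Rightarrow> real) \<Rightarrow> 'a \<Rightarrow> real" where
  "diff_op m Q k v x = (\<Sum>\<beta>\<in>multi_indices m. k \<beta> x * weak_deriv Q \<beta> v x)"

definition bounded_coeffs :: "nat \<Rightarrow> 'a::euclidean_space set \<Rightarrow> ('a multiset \<Rightarrow> 'a \<Rightarrow> real) \<Rightarrow> bool" where
  "bounded_coeffs m Q k \<longleftrightarrow> (\<forall>\<beta>\<in>multi_indices m. k \<beta> \<in> borel_measurable (lebesgue_on Q) \<and>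
     (\<exists>B. \<forall>x\<in>Q. \<bar>k \<beta> x\<bar> \<le> B))"

definition least_squares ::
    "nat \<Rightarrow> 'a::euclidean_space set \<Rightarrow> ('a multiset \<Rightarrow> 'a \<Rightarrow> real) \<Rightarrow> ('a \<Rightarrow> real) \<Rightarrow> real \<Rightarrow> ('a \<Rightarrow> real) \<Rightarrow> real"
  where
  "least_squares m Q k q \<alpha> v =
     (LINT x|lebesgue_on Q. (diff_op m Q k v x - q x)\<^sup>2) + \<alpha> * (sobolev_norm m Q v)\<^sup>2"

lemma diff_op_L2:
  assumes k: "bounded_coeffs m Q k" and v: "v \<in> sobolev m Q"
  shows "diff_op m Q k v \<in> L2 (lebesgue_on Q)"
  unfolding diff_op_def[abs_def]
proof (rule L2_sum[OF finite_multi_indices])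
  fix \<beta> :: "'a multiset" assume \<beta>: "\<beta> \<in> multi_indices m"
  obtain B where "k \<beta> \<in> borel_measurable (lebesgue_on Q)" "\<And>x. x \<in> Q \<Longrightarrow> \<bar>k \<beta> x\<bar> \<le> B"
    using k \<beta> unfolding bounded_coeffs_def by blast
  then show "(\<lambda>x. k \<beta> x * weak_deriv Q \<beta> v x) \<in> L2 (lebesgue_on Q)"
    by (intro L2_mult_bounded[OF weak_deriv_L2[OF v \<beta>], of _ B]) simp_all
qed

lemma diff_op_lincomb:
  assumes Q: "open Q" "bounded Q" and uv: "u \<in> sobolev m Q" "v \<in> sobolev m Q"
  shows "AE x in lebesgue_on Q. diff_op m Q k (\<lambda>x. c * u x + d * v x) x =
    c * diff_op m Q k u x + d * diff_op m Q k v x"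
proof -
  have "AE x in lebesgue_on Q. \<forall>\<beta>\<in>multi_indices m. weak_deriv Q \<beta> (\<lambda>x. c * u x + d * v x) x =
      c * weak_deriv Q \<beta> u x + d * weak_deriv Q \<beta> v x"
    by (intro AE_finite_allI finite_multi_indices weak_deriv_lincomb[OF Q uv])
  then show ?thesis
    by eventually_elim
       (simp add: diff_op_def sum_distrib_left sum.distrib[symmetric] algebra_simps)
qed

text \<open>Continuity of the operator from the Sobolev space to \<open>L\<^sub>2\<close>, by the Cauchy--Schwarz inequality
  for the finite sum over multi-indices.\<close>

lemma diff_op_bounded:
  assumes k: "bounded_coeffs m Q k"
  shows "\<exists>C. \<forall>v\<in>sobolev m Q. (LINT x|lebesgue_on Q. (diff_op m Q k v x)\<^sup>2) \<le> C * (sobolev_norm m Q v)\<^sup>2"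
proof -
  let ?I = "multi_indices m :: 'a multiset set"
  have "\<forall>\<beta>\<in>?I. \<exists>B. \<forall>x\<in>Q. \<bar>k \<beta> x\<bar> \<le> B" using k unfolding bounded_coeffs_def by blast
  from bchoice[OF this] obtain B where B: "\<forall>\<beta>\<in>?I. \<forall>x\<in>Q. \<bar>k \<beta> x\<bar> \<le> B \<beta>" ..
  define C where "C = (\<Sum>\<beta>\<in>?I. (B \<beta>)\<^sup>2) * real (card ?I)"
  have "(LINT x|lebesgue_on Q. (diff_op m Q k v x)\<^sup>2) \<le> C * (sobolev_norm m Q v)\<^sup>2"
    if v: "v \<in> sobolev m Q" for v
  proof -
    let ?D = "\<lambda>\<beta>. weak_deriv Q \<beta> v"
    have iD: "integrable (lebesgue_on Q) (\<lambda>x. (?D \<beta> x)\<^sup>2)" if "\<beta> \<in> ?I" for \<beta>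
      by (rule L2_integrable_power2[OF weak_deriv_L2[OF v that]])
    have "(LINT x|lebesgue_on Q. (diff_op m Q k v x)\<^sup>2) \<le>
        (LINT x|lebesgue_on Q. (\<Sum>\<beta>\<in>?I. (B \<beta>)\<^sup>2 * (?D \<beta> x)\<^sup>2) * real (card ?I))"
    proof (rule integral_mono)
      show "integrable (lebesgue_on Q) (\<lambda>x. (diff_op m Q k v x)\<^sup>2)"
        by (rule L2_integrable_power2[OF diff_op_L2[OF k v]])
      show "integrable (lebesgue_on Q) (\<lambda>x. (\<Sum>\<beta>\<in>?I. (B \<beta>)\<^sup>2 * (?D \<beta> x)\<^sup>2) * real (card ?I))"
        using iD by (intro integrable_mult_left Bochner_Integration.integrable_sum integrable_mult_right) auto
      fix x assume "x \<in> space (lebesgue_on Q)"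
      then have x: "x \<in> Q" by simp
      have "(diff_op m Q k v x)\<^sup>2 \<le> (\<Sum>\<beta>\<in>?I. (k \<beta> x * ?D \<beta> x)\<^sup>2) * real (card ?I)"
        unfolding diff_op_def by (rule sum_squared_le_sum_of_squares)
      also have "\<dots> \<le> (\<Sum>\<beta>\<in>?I. (B \<beta>)\<^sup>2 * (?D \<beta> x)\<^sup>2) * real (card ?I)"
      proof (intro mult_right_mono sum_mono)
        fix \<beta> assume "\<beta> \<in> ?I"
        then have "\<bar>k \<beta> x\<bar> \<le> B \<beta>" using B x by blast
        then have "\<bar>k \<beta> x\<bar>\<^sup>2 \<le> (B \<beta>)\<^sup>2" by (intro power_mono) auto
        then show "(k \<beta> x * ?D \<beta> x)\<^sup>2 \<le> (B \<beta>)\<^sup>2 * (?D \<beta> x)\<^sup>2"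
          unfolding power_mult_distrib by (intro mult_right_mono) simp_all
      qed simp
      finally show "(diff_op m Q k v x)\<^sup>2 \<le> (\<Sum>\<beta>\<in>?I. (B \<beta>)\<^sup>2 * (?D \<beta> x)\<^sup>2) * real (card ?I)" .
    qed
    also have "\<dots> = (\<Sum>\<beta>\<in>?I. (B \<beta>)\<^sup>2 * (LINT x|lebesgue_on Q. (?D \<beta> x)\<^sup>2)) * real (card ?I)"
      using iD by (simp add: Bochner_Integration.integral_sum)
    also have "\<dots> \<le> (\<Sum>\<beta>\<in>?I. (B \<beta>)\<^sup>2 * (sobolev_norm m Q v)\<^sup>2) * real (card ?I)"
      by (intro mult_right_mono sum_mono mult_left_mono weak_deriv_le_sobolev_norm) simp_all
    also have "\<dots> = C * (sobolev_norm m Q v)\<^sup>2"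
      unfolding C_def sum_distrib_right[symmetric] by (simp only: mult_ac)
    finally show ?thesis .
  qed
  then show ?thesis by blast
qed

text \<open>Uniform convexity. For the residual the convexity of the square suffices; the gain
  \<open>\<alpha> / 4 \<parallel>u - v\<parallel>\<^sup>2\<close> comes from the parallelogram law for the penalty term.\<close>

lemma least_squares_midpoint:
  assumes Q: "open Q" "bounded Q" and k: "bounded_coeffs m Q k" and q: "q \<in> L2 (lebesgue_on Q)"
    and uv: "u \<in> sobolev m Q" "v \<in> sobolev m Q"
  shows "least_squares m Q k q \<alpha> (\<lambda>x. (u x + v x) / 2) + \<alpha> / 4 * (sobolev_norm m Q (\<lambda>x. u x - v x))\<^sup>2
    \<le> (least_squares m Q k q \<alpha> u + least_squares m Q k q \<alpha> v) / 2"
proof -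
  let ?K = "diff_op m Q k" and ?w = "\<lambda>x. (u x + v x) / 2"
  have w: "?w = (\<lambda>x. 1/2 * u x + 1/2 * v x)" by (auto simp: field_simps)
  have ws: "?w \<in> sobolev m Q" unfolding w by (rule sobolev_lincomb[OF Q uv])
  have r: "(\<lambda>x. ?K f x - q x) \<in> L2 (lebesgue_on Q)" if "f \<in> sobolev m Q" for f
    by (rule L2_diff[OF diff_op_L2[OF k that] q])
  note i = L2_integrable_power2[OF r]
  have "(LINT x|lebesgue_on Q. (?K ?w x - q x)\<^sup>2) \<le>
      (LINT x|lebesgue_on Q. ((?K u x - q x)\<^sup>2 + (?K v x - q x)\<^sup>2) / 2)"
  proof (rule integral_mono_AE)
    show "integrable (lebesgue_on Q) (\<lambda>x. (?K ?w x - q x)\<^sup>2)" by (rule i[OF ws])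
    show "integrable (lebesgue_on Q) (\<lambda>x. ((?K u x - q x)\<^sup>2 + (?K v x - q x)\<^sup>2) / 2)"
      using i[OF uv(1)] i[OF uv(2)] by simp
    show "AE x in lebesgue_on Q. (?K ?w x - q x)\<^sup>2 \<le> ((?K u x - q x)\<^sup>2 + (?K v x - q x)\<^sup>2) / 2"
      using diff_op_lincomb[OF Q uv, of k "1/2" "1/2"]
    proof eventually_elim
      case (elim x)
      have "?K ?w x = (?K u x + ?K v x) / 2" unfolding w using elim by simp
      then have "?K ?w x - q x = ((?K u x - q x) + (?K v x - q x)) / 2"
        by (simp add: field_simps)
      then have "(?K ?w x - q x)\<^sup>2 = (((?K u x - q x) + (?K v x - q x)) / 2)\<^sup>2"
        by (rule arg_cong)
      also have "\<dots> \<le> ((?K u x - q x)\<^sup>2 + (?K v x - q x)\<^sup>2) / 2"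
        using Young_power2_sum[of 1 "?K u x - q x" "?K v x - q x"] by (simp add: power_divide)
      finally show ?case .
    qed
  qed
  also have "\<dots> = ((LINT x|lebesgue_on Q. (?K u x - q x)\<^sup>2) + (LINT x|lebesgue_on Q. (?K v x - q x)\<^sup>2)) / 2"
    using i[OF uv(1)] i[OF uv(2)] by simp
  finally have K: "(LINT x|lebesgue_on Q. (?K ?w x - q x)\<^sup>2) \<le> \<dots>" .
  have "\<alpha> * (sobolev_norm m Q ?w)\<^sup>2 + \<alpha> / 4 * (sobolev_norm m Q (\<lambda>x. u x - v x))\<^sup>2 =
      \<alpha> * ((sobolev_norm m Q ?w)\<^sup>2 + (sobolev_norm m Q (\<lambda>x. u x - v x))\<^sup>2 / 4)"
    by (simp add: algebra_simps)
  also have "\<dots> = (\<alpha> * (sobolev_norm m Q u)\<^sup>2 + \<alpha> * (sobolev_norm m Q v)\<^sup>2) / 2"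
    unfolding sobolev_norm_parallelogram[OF Q uv] by (simp add: algebra_simps)
  finally show ?thesis using K unfolding least_squares_def add_divide_distrib by linarith
qed

text \<open>The functional at \<open>v\<close> is compared with its value at a nearby \<open>u\<close>, at the price of a factor
  \<open>1 + e\<close>. Keeping \<open>e\<close> free avoids square roots: first \<open>u\<close> tends to \<open>v\<close>, then \<open>e\<close> to zero.\<close>

lemma least_squares_continuity:
  assumes Q: "open Q" "bounded Q" and k: "bounded_coeffs m Q k" and q: "q \<in> L2 (lebesgue_on Q)"
    and \<alpha>: "\<alpha> \<ge> 0"
  shows "\<exists>C. \<forall>u\<in>sobolev m Q. \<forall>v\<in>sobolev m Q. \<forall>e>0. least_squares m Q k q \<alpha> v \<le>
    (1 + e) * least_squares m Q k q \<alpha> u + (1 + 1 / e) * (C * (sobolev_norm m Q (\<lambda>x. u x - v x))\<^sup>2)"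
proof -
  let ?K = "diff_op m Q k"
  obtain C where C: "\<forall>v\<in>sobolev m Q. (LINT x|lebesgue_on Q. (?K v x)\<^sup>2) \<le> C * (sobolev_norm m Q v)\<^sup>2"
    using diff_op_bounded[OF k] by blast
  have "least_squares m Q k q \<alpha> v \<le>
    (1 + e) * least_squares m Q k q \<alpha> u + (1 + 1 / e) * ((C + \<alpha>) * (sobolev_norm m Q (\<lambda>x. u x - v x))\<^sup>2)"
    if u: "u \<in> sobolev m Q" and v: "v \<in> sobolev m Q" and e: "e > 0" for u v e
  proof -
    let ?d = "\<lambda>x. v x - u x"
    have d: "?d \<in> sobolev m Q" by (rule sobolev_diff[OF Q v u])
    have nd: "sobolev_norm m Q (\<lambda>x. u x - v x) = sobolev_norm m Q ?d"
      using sobolev_norm_scale[OF Q d, of "-1"] by simp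
    have r: "(\<lambda>x. ?K f x - q x) \<in> L2 (lebesgue_on Q)" if "f \<in> sobolev m Q" for f
      by (rule L2_diff[OF diff_op_L2[OF k that] q])
    note i = L2_integrable_power2[OF r] L2_integrable_power2[OF diff_op_L2[OF k d]]
    have "(LINT x|lebesgue_on Q. (?K v x - q x)\<^sup>2) \<le>
        (LINT x|lebesgue_on Q. (1 + e) * (?K u x - q x)\<^sup>2 + (1 + 1 / e) * (?K ?d x)\<^sup>2)"
    proof (rule integral_mono_AE)
      show "integrable (lebesgue_on Q) (\<lambda>x. (?K v x - q x)\<^sup>2)" by (rule i(1)[OF v])
      show "integrable (lebesgue_on Q) (\<lambda>x. (1 + e) * (?K u x - q x)\<^sup>2 + (1 + 1 / e) * (?K ?d x)\<^sup>2)"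
        using i(1)[OF u] i(2) by simp
      show "AE x in lebesgue_on Q. (?K v x - q x)\<^sup>2 \<le> (1 + e) * (?K u x - q x)\<^sup>2 + (1 + 1 / e) * (?K ?d x)\<^sup>2"
        using diff_op_lincomb[OF Q v u, of k 1 "-1"]
      proof eventually_elim
        case (elim x)
        then have "?K v x - q x = (?K u x - q x) + ?K ?d x" by simp
        then show ?case using Young_power2_sum[OF e] by metis
      qed
    qed
    also have "\<dots> = (1 + e) * (LINT x|lebesgue_on Q. (?K u x - q x)\<^sup>2) + (1 + 1 / e) * (LINT x|lebesgue_on Q. (?K ?d x)\<^sup>2)"
      using i(1)[OF u] i(2) by simp
    also have "\<dots> \<le> (1 + e) * (LINT x|lebesgue_on Q. (?K u x - q x)\<^sup>2) + (1 + 1 / e) * (C * (sobolev_norm m Q ?d)\<^sup>2)"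
      using C d e by (intro add_left_mono mult_left_mono) auto
    finally have K: "(LINT x|lebesgue_on Q. (?K v x - q x)\<^sup>2) \<le> \<dots>" .
    have "(sobolev_norm m Q v)\<^sup>2 \<le> (1 + e) * (sobolev_norm m Q u)\<^sup>2 + (1 + 1 / e) * (sobolev_norm m Q ?d)\<^sup>2"
      using sobolev_norm_add_le[OF Q u d e] by simp
    from mult_left_mono[OF this \<alpha>]
    have "\<alpha> * (sobolev_norm m Q v)\<^sup>2 \<le>
        (1 + e) * (\<alpha> * (sobolev_norm m Q u)\<^sup>2) + (1 + 1 / e) * (\<alpha> * (sobolev_norm m Q ?d)\<^sup>2)"
      by (simp add: algebra_simps)
    with K show ?thesis
      unfolding least_squares_def nd by (simp only: distrib_left distrib_right)
  qed
  then show ?thesis by blast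
qed

text \<open>The direct method with strong convergence: uniform convexity makes every minimizing sequence a
  Cauchy sequence, its limit is admissible, and continuity carries the infimum over to the limit.\<close>

lemma least_squares_unique_minimizer:
  assumes Q: "open Q" "bounded Q" and k: "bounded_coeffs m Q k" and q: "q \<in> L2 (lebesgue_on Q)"
    and \<alpha>: "\<alpha> > 0" and X: "X \<subseteq> sobolev m Q" "X \<noteq> {}"
    and midpoint: "\<And>u v. u \<in> X \<Longrightarrow> v \<in> X \<Longrightarrow> (\<lambda>x. (u x + v x) / 2) \<in> X"
    and closed: "\<And>u v. (\<And>n. u n \<in> X) \<Longrightarrow> v \<in> sobolev m Q \<Longrightarrow>
      (\<lambda>n::nat. sobolev_norm m Q (\<lambda>x. u n x - v x)) \<longlonglongrightarrow> 0 \<Longrightarrow> v \<in> X"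
  shows "\<exists>v. is_arg_min (least_squares m Q k q \<alpha>) (\<lambda>v. v \<in> X) v \<and>
    (\<forall>w. is_arg_min (least_squares m Q k q \<alpha>) (\<lambda>v. v \<in> X) w \<longrightarrow> (AE x in lebesgue_on Q. w x = v x))"
proof -
  let ?J = "least_squares m Q k q \<alpha>"
  let ?N = "\<lambda>u v. (sobolev_norm m Q (\<lambda>x. u x - v x))\<^sup>2"
  define I where "I = (INF v\<in>X. ?J v)"
  have J0: "0 \<le> ?J v" for v
    unfolding least_squares_def using \<alpha> by (intro add_nonneg_nonneg mult_nonneg_nonneg integral_nonneg_AE) simp_all
  have bdd: "bdd_below (?J ` X)" using J0 by (intro bdd_belowI2) auto
  have IJ: "I \<le> ?J v" if "v \<in> X" for v
    unfolding I_def by (rule cINF_lower[OF bdd that])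
  \<comment> \<open>The midpoint is admissible, so its value is at least the infimum.\<close>
  have dist: "\<alpha> / 4 * ?N u v \<le> (?J u + ?J v) / 2 - I" if "u \<in> X" "v \<in> X" for u v
  proof -
    have "u \<in> sobolev m Q" "v \<in> sobolev m Q" using that X(1) by auto
    from least_squares_midpoint[OF Q k q this, of \<alpha>]
    have "\<alpha> / 4 * ?N u v \<le> (?J u + ?J v) / 2 - ?J (\<lambda>x. (u x + v x) / 2)"
      by (simp only: le_diff_eq add.commute)
    also have "\<dots> \<le> (?J u + ?J v) / 2 - I"
      by (rule diff_left_mono[OF IJ[OF midpoint[OF that]]])
    finally show ?thesis .
  qed
  have "\<exists>v. v \<in> X \<and> ?J v < I + inverse (real (Suc n))" for n
    using cINF_less_iff[OF X(2) bdd, of "I + inverse (real (Suc n))"] unfolding I_def by auto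
  then have "\<exists>u. \<forall>n. u n \<in> X \<and> ?J (u n) < I + inverse (real (Suc n))"
    by (intro choice allI)
  then obtain u where u': "\<forall>n. u n \<in> X \<and> ?J (u n) < I + inverse (real (Suc n))" ..
  then have u: "\<And>n. u n \<in> X" "\<And>n. ?J (u n) < I + inverse (real (Suc n))" by auto
  have us: "u n \<in> sobolev m Q" for n using u(1) X(1) by blast
  have "\<exists>N. \<forall>i\<ge>N. \<forall>j\<ge>N. ?N (u i) (u j) < e" if e: "e > 0" for e
  proof -
    obtain N where N: "inverse (real (Suc N)) < \<alpha> / 4 * e"
      using reals_Archimedean[of "\<alpha> / 4 * e"] \<alpha> e by auto
    have "?N (u i) (u j) < e" if "i \<ge> N" "j \<ge> N" for i j
    proof -
      have "inverse (real (Suc i)) \<le> inverse (real (Suc N))" "inverse (real (Suc j)) \<le> inverse (real (Suc N))"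
        using that by (auto intro!: le_imp_inverse_le)
      then have "?J (u i) < I + inverse (real (Suc N))" "?J (u j) < I + inverse (real (Suc N))"
        using u(2)[of i] u(2)[of j] by (meson add_left_mono less_le_trans)+
      moreover have "(x + y) / 2 - z < r" if "x < z + r" "y < z + r" for x y z r :: real
        using that by (simp add: field_simps)
      ultimately have "(?J (u i) + ?J (u j)) / 2 - I < inverse (real (Suc N))" by blast
      then have "\<alpha> / 4 * ?N (u i) (u j) < \<alpha> / 4 * e"
        using dist[OF u(1)[of i] u(1)[of j]] N by (meson le_less_trans less_trans)
      then show ?thesis using \<alpha> by simp
    qed
    then show ?thesis by blast
  qed
  from sobolev_complete[OF Q us this]
  obtain v where v: "v \<in> sobolev m Q" "(\<lambda>n. sobolev_norm m Q (\<lambda>x. u n x - v x)) \<longlonglongrightarrow> 0" by blast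
  have vX: "v \<in> X" by (rule closed[OF u(1) v])
  obtain C where C: "\<forall>u\<in>sobolev m Q. \<forall>v\<in>sobolev m Q. \<forall>e>0. ?J v \<le> (1 + e) * ?J u + (1 + 1 / e) * (C * ?N u v)"
    using least_squares_continuity[OF Q k q less_imp_le[OF \<alpha>]] by blast
  have Jv: "?J v \<le> (1 + e) * I" if e: "e > 0" for e
  proof -
    have "(\<lambda>n. (1 + e) * (I + inverse (real (Suc n))) + (1 + 1 / e) * (C * ?N (u n) v))
        \<longlonglongrightarrow> (1 + e) * (I + 0) + (1 + 1 / e) * (C * 0\<^sup>2)"
      by (intro tendsto_intros v(2) LIMSEQ_inverse_real_of_nat)
    moreover have "?J v \<le> (1 + e) * (I + inverse (real (Suc n))) + (1 + 1 / e) * (C * ?N (u n) v)" for n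
    proof -
      have "?J v \<le> (1 + e) * ?J (u n) + (1 + 1 / e) * (C * ?N (u n) v)"
        using C us v(1) e by blast
      also have "\<dots> \<le> (1 + e) * (I + inverse (real (Suc n))) + (1 + 1 / e) * (C * ?N (u n) v)"
        using u(2)[of n] e by (intro add_right_mono mult_left_mono) simp_all
      finally show ?thesis .
    qed
    ultimately have "?J v \<le> (1 + e) * (I + 0) + (1 + 1 / e) * (C * 0\<^sup>2)"
      by (intro LIMSEQ_le_const[of _ _ "?J v"]) auto
    then show ?thesis by simp
  qed
  \<comment> \<open>The constant in the continuity estimate blows up as \<open>e\<close> tends to zero, so this limit can only be
    taken after the one along the minimizing sequence.\<close>
  have "((\<lambda>e. (1 + e) * I) \<longlongrightarrow> (1 + 0) * I) (at_right 0)"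
    by (intro tendsto_intros)
  then have "?J v \<le> (1 + 0) * I"
    by (rule tendsto_lowerbound) (use Jv in \<open>auto intro: eventually_at_right_less[THEN eventually_mono]\<close>)
  then have JvI: "?J v = I" using IJ[OF vX] by simp
  have min: "is_arg_min ?J (\<lambda>v. v \<in> X) v"
    unfolding is_arg_min_def using vX IJ JvI by (auto simp: not_less)
  moreover have "AE x in lebesgue_on Q. w x = v x" if w: "is_arg_min ?J (\<lambda>v. v \<in> X) w" for w
  proof -
    have wX: "w \<in> X" and "?J w \<le> ?J v" using w vX unfolding is_arg_min_def by auto
    then have "(?J w + ?J v) / 2 - I \<le> 0" using JvI by simp
    with dist[OF wX vX] have "\<alpha> / 4 * ?N w v \<le> 0" by (rule order_trans)
    then have N0: "?N w v \<le> 0" using \<alpha> by (simp add: mult_le_0_iff)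
    have d: "(\<lambda>x. w x - v x) \<in> sobolev m Q" using wX vX X(1) by (intro sobolev_diff Q) auto
    have "(LINT x|lebesgue_on Q. (weak_deriv Q {#} (\<lambda>x. w x - v x) x)\<^sup>2) = 0"
    proof (rule antisym)
      show "(LINT x|lebesgue_on Q. (weak_deriv Q {#} (\<lambda>x. w x - v x) x)\<^sup>2) \<le> 0"
        using order_trans[OF weak_deriv_le_sobolev_norm[OF empty_multi_index] N0] .
    qed (intro integral_nonneg_AE, simp)
    then have "AE x in lebesgue_on Q. (weak_deriv Q {#} (\<lambda>x. w x - v x) x)\<^sup>2 = 0"
      by (subst (asm) integral_nonneg_eq_0_iff_AE[OF L2_integrable_power2[OF weak_deriv_L2[OF d empty_multi_index]]]) simp_all
    then show ?thesis
      using weak_deriv_empty[OF Q sobolev_imp_L2[OF d]] by eventually_elim simp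
  qed
  ultimately show ?thesis by blast
qed

section \<open>Functions of the space variable on the cylinder\<close>

lemma null_sets_lborel_fst:
  assumes "N \<in> null_sets (lborel :: 'a::euclidean_space measure)"
  shows "N \<times> (UNIV :: 'b::euclidean_space set) \<in> null_sets lborel"
proof -
  have "N \<times> (UNIV :: 'b set) \<in> null_sets (lborel \<Otimes>\<^sub>M lborel)"
    by (rule lborel.times_in_null_sets1[OF assms]) simp
  then show ?thesis by (simp add: lborel_prod)
qed

text \<open>Not implied by Borel measurability: preimages of Lebesgue null sets must be measurable as
  well, and they are null sets by the product formula.\<close>

lemma fst_measurable_lebesgue:
  "fst \<in> measurable (lebesgue :: ('a::euclidean_space \<times> 'b::euclidean_space) measure) lebesgue"
proof (rule completion.measurable_completion2)
  show m: "fst \<in> measurable (lebesgue :: ('a \<times> 'b) measure) lborel"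
    by (rule measurable_completion) (simp flip: borel_prod)
  show "null_sets lborel \<subseteq> null_sets (distr (lebesgue :: ('a \<times> 'b) measure) lborel fst)"
  proof
    fix N :: "'a set" assume N: "N \<in> null_sets lborel"
    have "N \<times> (UNIV :: 'b set) \<in> null_sets lebesgue"
      using N by (intro null_sets_completionI null_sets_lborel_fst)
    moreover have "fst -` N \<inter> space (lebesgue :: ('a \<times> 'b) measure) = N \<times> UNIV" by auto
    ultimately have "emeasure lebesgue (fst -` N \<inter> space (lebesgue :: ('a \<times> 'b) measure)) = 0"
      by (simp only: null_setsD1)
    then show "N \<in> null_sets (distr (lebesgue :: ('a \<times> 'b) measure) lborel fst)"
      using N null_setsD2[OF N] by (intro null_setsI) (simp_all only: emeasure_distr[OF m] sets_distr)
  qed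
qed

text \<open>Fubini's theorem is applied to a Borel function that agrees with \<open>f\<^sup>2\<close> almost everywhere,
  because the product of the Borel measure spaces is the Borel measure on the product, whereas
  the Lebesgue measure on the product is only its completion.\<close>

lemma L2_fst:
  fixes f :: "'a::euclidean_space \<Rightarrow> real" and J :: "'b::euclidean_space set"
  assumes \<Omega>: "open \<Omega>" and J: "open J" "bounded J" and f: "f \<in> L2 (lebesgue_on \<Omega>)"
  shows "(\<lambda>z. f (fst z)) \<in> L2 (lebesgue_on (\<Omega> \<times> J))"
proof -
  have \<Omega>m: "\<Omega> \<in> sets lebesgue" and Qm: "\<Omega> \<times> J \<in> sets lebesgue"
    using \<Omega> J by (auto simp: open_Times)
  have fm: "(\<lambda>x. indicator \<Omega> x *\<^sub>R f x) \<in> borel_measurable lebesgue"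
    using L2_measurable[OF f] \<Omega>m by (simp add: borel_measurable_restrict_space_iff)
  have gm: "(\<lambda>z. indicator (\<Omega> \<times> J) z *\<^sub>R f (fst z)) \<in> borel_measurable lebesgue"
  proof -
    have "(\<lambda>z. indicator \<Omega> (fst z) *\<^sub>R f (fst z)) \<in> borel_measurable (lebesgue :: ('a \<times> 'b) measure)"
      by (rule measurable_compose[OF fst_measurable_lebesgue fm])
    then have "(\<lambda>z. indicator (\<Omega> \<times> J) z * (indicator \<Omega> (fst z) *\<^sub>R f (fst z))) \<in> borel_measurable lebesgue"
      using Qm by (intro borel_measurable_times borel_measurable_indicator)
    also have "(\<lambda>z. indicator (\<Omega> \<times> J) z * (indicator \<Omega> (fst z) *\<^sub>R f (fst z))) =
        (\<lambda>z. indicator (\<Omega> \<times> J) z *\<^sub>R f (fst z))"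
      by (auto simp: indicator_def)
    finally show ?thesis .
  qed
  define h where "h x = indicator \<Omega> x *\<^sub>R (f x)\<^sup>2" for x
  have hi: "integrable lebesgue h"
    using L2_integrable_power2[OF f] \<Omega>m unfolding h_def[abs_def] by (simp add: integrable_restrict_space)
  obtain g where g: "g \<in> borel_measurable lborel" "AE x in lborel. h x = g x"
    using completion_ex_borel_measurable_real[OF borel_measurable_integrable[OF hi]] by blast
  have "integrable lebesgue g"
    using hi by (rule integrable_cong_AE_imp) (use g in \<open>auto intro: measurable_completion AE_completion elim: AE_mp\<close>)
  then have gi: "integrable lborel g" using g(1) by (simp add: integrable_completion)
  let ?G = "\<lambda>z. g (fst z) * indicator J (snd z) :: real"
  have Ji: "integrable lborel (indicator J :: 'b \<Rightarrow> real)"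
    by (rule integrable_real_indicator) (use J emeasure_bounded_finite[OF J(2)] in auto)
  have "integrable (lborel \<Otimes>\<^sub>M lborel) ?G"
  proof (rule lborel_pair.Fubini_integrable)
    have Jb: "J \<in> sets borel" using J by simp
    show "?G \<in> borel_measurable (lborel \<Otimes>\<^sub>M lborel)"
      using g(1) Jb by measurable
    show "integrable lborel (\<lambda>x. LINT y|lborel. norm (?G (x, y)))"
      using gi Ji by (simp add: abs_mult)
    show "AE x in lborel. integrable lborel (\<lambda>y. ?G (x, y))"
      using Ji by simp
  qed
  then have "integrable lborel ?G" by (simp add: lborel_prod)
  then have Gi: "integrable lebesgue ?G"
    by (subst integrable_completion) auto
  have "integrable lebesgue (\<lambda>z. indicator (\<Omega> \<times> J) z *\<^sub>R (f (fst z))\<^sup>2)"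
  proof (rule integrable_cong_AE_imp[OF Gi])
    have "(\<lambda>z. (indicator (\<Omega> \<times> J) z *\<^sub>R f (fst z))\<^sup>2) \<in> borel_measurable lebesgue"
      using gm by (rule borel_measurable_power)
    also have "(\<lambda>z. (indicator (\<Omega> \<times> J) z *\<^sub>R f (fst z))\<^sup>2) = (\<lambda>z. indicator (\<Omega> \<times> J) z *\<^sub>R (f (fst z))\<^sup>2)"
      by (auto simp: indicator_def)
    finally show "(\<lambda>z. indicator (\<Omega> \<times> J) z *\<^sub>R (f (fst z))\<^sup>2) \<in> borel_measurable lebesgue" .
    obtain N where N: "{x \<in> space lborel. h x \<noteq> g x} \<subseteq> N" "N \<in> null_sets lborel"
      using g(2) by (auto elim!: AE_E simp: null_sets_def)
    have "AE z in lebesgue. h (fst z) = g (fst z)"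
      by (rule AE_I'[OF null_sets_completionI[OF null_sets_lborel_fst[OF N(2)]]])
         (use N(1) in auto)
    then show "AE z in lebesgue. ?G z = indicator (\<Omega> \<times> J) z *\<^sub>R (f (fst z))\<^sup>2"
    proof eventually_elim
      case (elim z)
      have "?G z = h (fst z) * indicator J (snd z)" by (simp only: elim)
      also have "\<dots> = indicator (\<Omega> \<times> J) z *\<^sub>R (f (fst z))\<^sup>2"
        by (cases z) (simp add: h_def indicator_def)
      finally show ?case .
    qed
  qed
  then have "integrable (lebesgue_on (\<Omega> \<times> J)) (\<lambda>z. (f (fst z))\<^sup>2)"
    using Qm by (simp add: integrable_restrict_space)
  moreover have "(\<lambda>z. f (fst z)) \<in> borel_measurable (lebesgue_on (\<Omega> \<times> J))"
    using gm Qm by (simp add: borel_measurable_restrict_space_iff)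
  ultimately show ?thesis by (simp add: L2_def)
qed

section \<open>The parabolic operator\<close>

lemma ex_in_Basis: "(ex i :: (real^'n) \<times> real) \<in> Basis" and et_in_Basis: "(et :: (real^'n) \<times> real) \<in> Basis"
  by (auto simp: Basis_prod_def axis_in_Basis_iff)

text \<open>The coefficients of \<open>\<partial>\<^sub>t - L - A\<close>. Several pairs \<open>(i, j)\<close> may have the same multi-index,
  so they are collected by summing over all pairs.\<close>

definition parabolic_coeff ::
    "('n::finite \<Rightarrow> 'n \<Rightarrow> (real^'n) \<times> real \<Rightarrow> real) \<Rightarrow> ('n \<Rightarrow> (real^'n) \<times> real \<Rightarrow> real) \<Rightarrow>
     ((real^'n) \<times> real \<Rightarrow> real) \<Rightarrow> ((real^'n) \<times> real) multiset \<Rightarrow> (real^'n) \<times> real \<Rightarrow> real" where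
  "parabolic_coeff a b c \<beta> z =
     of_bool (\<beta> = {#et#}) - (\<Sum>i\<in>UNIV. \<Sum>j\<in>UNIV. of_bool (\<beta> = {#ex i, ex j#}) * a i j z)
     - (\<Sum>j\<in>UNIV. of_bool (\<beta> = {#ex j#}) * b j z) - of_bool (\<beta> = {#}) * c z"

lemma diff_op_parabolic_coeff:
  "diff_op 2 Q (parabolic_coeff a b c) v z =
     weak_deriv Q {#et#} v z - L_cyl Q a v z
     - (\<Sum>j\<in>UNIV. b j z * weak_deriv Q {#ex j#} v z) - c z * weak_deriv Q {#} v z"
proof -
  let ?I = "multi_indices 2 :: ((real^'n) \<times> real) multiset set"
  have pick: "(\<Sum>\<beta>\<in>?I. of_bool (\<beta> = \<gamma>) * r * weak_deriv Q \<beta> v z) = r * weak_deriv Q \<gamma> v z"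
    if "\<gamma> \<in> ?I" for \<gamma> r
  proof -
    have "(\<Sum>\<beta>\<in>?I. of_bool (\<beta> = \<gamma>) * r * weak_deriv Q \<beta> v z) =
        (\<Sum>\<beta>\<in>?I. if \<beta> = \<gamma> then r * weak_deriv Q \<gamma> v z else 0)"
      by (rule sum.cong) auto
    then show ?thesis using that by (simp add: sum.delta[OF finite_multi_indices])
  qed
  have mem: "{#et#} \<in> ?I" "{#ex i, ex j#} \<in> ?I" "{#ex j#} \<in> ?I" "{#} \<in> ?I" for i j
    by (simp_all add: multi_indices_def ex_in_Basis et_in_Basis)
  have 2: "(\<Sum>\<beta>\<in>?I. (\<Sum>i\<in>UNIV. \<Sum>j\<in>UNIV. of_bool (\<beta> = {#ex i, ex j#}) * a i j z) * weak_deriv Q \<beta> v z) =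
      L_cyl Q a v z"
  proof -
    have "(\<Sum>\<beta>\<in>?I. (\<Sum>i\<in>UNIV. \<Sum>j\<in>UNIV. of_bool (\<beta> = {#ex i, ex j#}) * a i j z) * weak_deriv Q \<beta> v z) =
        (\<Sum>i\<in>UNIV. \<Sum>j\<in>UNIV. \<Sum>\<beta>\<in>?I. of_bool (\<beta> = {#ex i, ex j#}) * a i j z * weak_deriv Q \<beta> v z)"
      unfolding sum_distrib_right by (subst sum.swap, intro sum.cong refl, rule sum.swap)
    then show ?thesis unfolding L_cyl_def op_L_def by (simp only: pick[OF mem(2)])
  qed
  have 1: "(\<Sum>\<beta>\<in>?I. (\<Sum>j\<in>UNIV. of_bool (\<beta> = {#ex j#}) * b j z) * weak_deriv Q \<beta> v z) =
      (\<Sum>j\<in>UNIV. b j z * weak_deriv Q {#ex j#} v z)"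
    unfolding sum_distrib_right by (subst sum.swap) (simp only: pick[OF mem(3)])
  show ?thesis
    unfolding diff_op_def parabolic_coeff_def left_diff_distrib sum_subtractf 2 1 pick[OF mem(4)]
    using pick[OF mem(1), of 1] by simp
qed

lemma bounded_coeffs_parabolic:
  assumes Q: "open Q" "bounded Q" and a: "\<And>i j. continuous_on (closure Q) (a i j)"
    and b: "\<And>j. continuous_on (closure Q) (b j)" and c: "continuous_on (closure Q) c"
  shows "bounded_coeffs m Q (parabolic_coeff a b c)"
proof -
  have k: "continuous_on (closure Q) (parabolic_coeff a b c \<beta>)" for \<beta>
    unfolding parabolic_coeff_def[abs_def] by (intro continuous_intros a b c)
  show ?thesis
    unfolding bounded_coeffs_def
    using continuous_on_closure_measurable[OF Q(1) k] continuous_on_closure_bounded[OF Q(2) k] by metis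
qed

text \<open>The only difference between the two functionals is that \<open>A\<close> uses the function itself where
  the general operator uses its weak derivative of order zero.\<close>

lemma tikhonov_eq_least_squares:
  assumes Q: "open Q" "bounded Q" and a: "\<And>i j. continuous_on (closure Q) (a i j)"
    and b: "\<And>j. continuous_on (closure Q) (b j)" and c: "continuous_on (closure Q) c"
    and q: "q \<in> L2 (lebesgue_on Q)" and v: "v \<in> sobolev 2 Q"
  shows "tikhonov Q a b c q \<alpha> v = least_squares 2 Q (parabolic_coeff a b c) q \<alpha> v"
proof -
  let ?K = "diff_op 2 Q (parabolic_coeff a b c) v"
  let ?R = "\<lambda>z. weak_deriv Q {#et#} v z - L_cyl Q a v z - A_cyl Q b c v z - q z"
  have R: "?R z = (?K z - q z) + (c z * weak_deriv Q {#} v z - c z * v z)" for z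
    unfolding diff_op_parabolic_coeff A_cyl_def op_A_def by simp
  obtain B where B: "\<And>x. x \<in> Q \<Longrightarrow> \<bar>c x\<bar> \<le> B" using continuous_on_closure_bounded[OF Q(2) c] by blast
  have cL2: "(\<lambda>z. c z * f z) \<in> L2 (lebesgue_on Q)" if "f \<in> L2 (lebesgue_on Q)" for f
    using B by (intro L2_mult_bounded[OF that continuous_on_closure_measurable[OF Q(1) c]]) simp
  have r: "(\<lambda>z. ?K z - q z) \<in> L2 (lebesgue_on Q)"
    by (rule L2_diff[OF diff_op_L2[OF bounded_coeffs_parabolic[OF Q a b c] v] q])
  have "(LINT z|lebesgue_on Q. (?R z)\<^sup>2) = (LINT z|lebesgue_on Q. (?K z - q z)\<^sup>2)"
  proof (rule integral_cong_AE)
    have "?R \<in> L2 (lebesgue_on Q)"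
      unfolding R by (rule L2_add[OF r L2_diff[OF cL2[OF weak_deriv_L2[OF v empty_multi_index]]
              cL2[OF sobolev_imp_L2[OF v]]]])
    then show "(\<lambda>z. (?R z)\<^sup>2) \<in> borel_measurable (lebesgue_on Q)"
      by (rule borel_measurable_power[OF L2_measurable])
    show "(\<lambda>z. (?K z - q z)\<^sup>2) \<in> borel_measurable (lebesgue_on Q)"
      by (rule borel_measurable_power[OF L2_measurable[OF r]])
    show "AE z in lebesgue_on Q. (?R z)\<^sup>2 = (?K z - q z)\<^sup>2"
      using weak_deriv_empty[OF Q sobolev_imp_L2[OF v]] unfolding R by eventually_elim simp
  qed
  then show ?thesis unfolding tikhonov_def least_squares_def by simp
qed

lemma L2_continuous_mult_fst:
  assumes \<Omega>: "bounded_domain \<Omega>" and Q: "Q = cylinder \<Omega> T"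
    and k: "continuous_on (closure Q) k" and w: "w \<in> L2 (lebesgue_on \<Omega>)"
  shows "(\<lambda>z. k z * w (fst z)) \<in> L2 (lebesgue_on Q)"
proof -
  note oQ = cylinder_open_bounded[OF \<Omega>, of T, folded Q]
  obtain B where B: "\<And>x. x \<in> Q \<Longrightarrow> \<bar>k x\<bar> \<le> B" using continuous_on_closure_bounded[OF oQ(2) k] by blast
  have "(\<lambda>z. w (fst z)) \<in> L2 (lebesgue_on Q)"
    unfolding Q cylinder_def using \<Omega> by (intro L2_fst w) (auto simp: bounded_domain_def)
  then show ?thesis
    using B by (intro L2_mult_bounded[OF _ continuous_on_closure_measurable[OF oQ(1) k]]) simp_all
qed

text \<open>Each summand is a continuous function on the closed cylinder times a square-integrable
  function of \<open>x\<close> alone.\<close>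

lemma source_L2:
  fixes \<Omega> :: "(real^'n) set"
  assumes \<Omega>: "bounded_domain \<Omega>" and Q: "Q = cylinder \<Omega> T"
    and a: "\<And>i j. continuous_on (closure Q) (a i j)" and b: "\<And>j. continuous_on (closure Q) (b j)"
    and c: "continuous_on (closure Q) c" and p: "continuous_on (closure Q) p"
    and g: "g \<in> sobolev 2 \<Omega>"
  shows "(\<lambda>z. L_dom \<Omega> a g z + A_dom \<Omega> b c g z + p z) \<in> L2 (lebesgue_on Q)"
proof -
  note oQ = cylinder_open_bounded[OF \<Omega>, of T, folded Q]
  note M = L2_continuous_mult_fst[OF \<Omega> Q]
  have mem: "{#axis i 1, axis j 1#} \<in> (multi_indices 2 :: (real^'n) multiset set)"
    "{#axis j 1#} \<in> (multi_indices 2 :: (real^'n) multiset set)" for i j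
    by (simp_all add: multi_indices_def axis_in_Basis_iff)
  have "L_dom \<Omega> a g = (\<lambda>z. \<Sum>i\<in>UNIV. \<Sum>j\<in>UNIV. a i j z * weak_deriv \<Omega> {#axis i 1, axis j 1#} g (fst z))"
    unfolding L_dom_def op_L_def[abs_def] by (simp add: case_prod_beta)
  moreover have "\<dots> \<in> L2 (lebesgue_on Q)"
    by (intro L2_sum finite_class.finite_UNIV M a weak_deriv_L2[OF g mem(1)])
  moreover have "A_dom \<Omega> b c g = (\<lambda>z. (\<Sum>j\<in>UNIV. b j z * weak_deriv \<Omega> {#axis j 1#} g (fst z)) + c z * g (fst z))"
    unfolding A_dom_def op_A_def[abs_def] by (simp add: case_prod_beta)
  moreover have "\<dots> \<in> L2 (lebesgue_on Q)"
    by (intro L2_add L2_sum finite_class.finite_UNIV M b c weak_deriv_L2[OF g mem(2)] sobolev_imp_L2[OF g])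
  ultimately show ?thesis
    by (intro L2_add continuous_on_closure_L2[OF oQ p]) simp_all
qed

section \<open>Existence and uniqueness of the minimizer\<close>

theorem theorem4p1:
  fixes \<Omega> :: "(real^'n) set" and T \<mu>1 \<mu>2 \<alpha> :: real
    and a :: "'n \<Rightarrow> 'n \<Rightarrow> (real^'n) \<times> real \<Rightarrow> real"
    and b :: "'n \<Rightarrow> (real^'n) \<times> real \<Rightarrow> real"
    and c p q :: "(real^'n) \<times> real \<Rightarrow> real"
    and g :: "real^'n \<Rightarrow> real"
    and Q :: "((real^'n) \<times> real) set"
  assumes "Q = cylinder \<Omega> T"
    and "bounded_domain \<Omega>" and "piecewise_smooth_boundary \<Omega>" and "T > 0"
    and "\<And>i j. a i j \<in> C1_closure Q"
    and "\<And>i j z. z \<in> closure Q \<Longrightarrow> a i j z = a j i z"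
    and "0 < \<mu>1" and "\<mu>1 \<le> \<mu>2"
    and "\<And>z (\<xi> :: real^'n). z \<in> closure Q \<Longrightarrow>
           \<mu>1 * (norm \<xi>)\<^sup>2 \<le> (\<Sum>i\<in>UNIV. \<Sum>j\<in>UNIV. a i j z * \<xi> $ i * \<xi> $ j) \<and>
           (\<Sum>i\<in>UNIV. \<Sum>j\<in>UNIV. a i j z * \<xi> $ i * \<xi> $ j) \<le> \<mu>2 * (norm \<xi>)\<^sup>2"
    and "\<And>j. continuous_on (closure Q) (b j)"
    and "continuous_on (closure Q) c"
    and "continuous_on (closure Q) p"
    and "g \<in> sobolev 2 \<Omega>" and "has_trace \<Omega> (frontier \<Omega>) g (\<lambda>_. 0)"
    and "0 < \<alpha>" and "\<alpha> < 1"
    and "\<And>z. z \<in> Q \<Longrightarrow> q z = L_dom \<Omega> a g z + A_dom \<Omega> b c g z + p z"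
  shows "q \<in> L2 (lebesgue_on Q) \<and>
    (\<exists>v_min. is_arg_min (tikhonov Q a b c q \<alpha>) (\<lambda>v. v \<in> H20 \<Omega> T) v_min \<and>
       (\<forall>v. is_arg_min (tikhonov Q a b c q \<alpha>) (\<lambda>v. v \<in> H20 \<Omega> T) v \<longrightarrow>
          (AE z in lebesgue_on Q. v z = v_min z)))"
proof -
  note Q_eq = assms(1) and \<Omega> = assms(2) and T = assms(4)
  note Q = cylinder_open_bounded[OF \<Omega>, of T, folded Q_eq]
  have a: "continuous_on (closure Q) (a i j)" for i j
    using assms(5)[of i j] by (simp add: C1_closure_def)
  note b = assms(10) and c = assms(11)
  let ?J = "tikhonov Q a b c q \<alpha>"
  let ?F = "least_squares 2 Q (parabolic_coeff a b c) q \<alpha>"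
  have q: "q \<in> L2 (lebesgue_on Q)"
    by (rule L2_cong[OF source_L2[OF \<Omega> Q_eq a b c assms(12,13)]]) (simp add: assms(17))
  have H: "H20 \<Omega> T \<subseteq> sobolev 2 Q" unfolding H20_def Q_eq by auto
  have "?J v = ?F v" if "v \<in> H20 \<Omega> T" for v
    using H that by (intro tikhonov_eq_least_squares[OF Q a b c q]) auto
  then have arg_min: "is_arg_min ?J (\<lambda>v. v \<in> H20 \<Omega> T) v \<longleftrightarrow> is_arg_min ?F (\<lambda>v. v \<in> H20 \<Omega> T) v" for v
    unfolding is_arg_min_def by auto
  have "\<exists>v. is_arg_min ?F (\<lambda>v. v \<in> H20 \<Omega> T) v \<and>
      (\<forall>w. is_arg_min ?F (\<lambda>v. v \<in> H20 \<Omega> T) w \<longrightarrow> (AE x in lebesgue_on Q. w x = v x))"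
  proof (rule least_squares_unique_minimizer[OF Q bounded_coeffs_parabolic[OF Q a b c] q assms(15) H])
    show "H20 \<Omega> T \<noteq> {}" using H20_0[OF \<Omega>] by blast
    show "(\<lambda>x. (u x + v x) / 2) \<in> H20 \<Omega> T" if "u \<in> H20 \<Omega> T" "v \<in> H20 \<Omega> T" for u v
      by (rule H20_midpoint[OF \<Omega> T that])
    show "v \<in> H20 \<Omega> T" if "\<And>n. u n \<in> H20 \<Omega> T" "v \<in> sobolev 2 Q"
      "(\<lambda>n::nat. sobolev_norm 2 Q (\<lambda>x. u n x - v x)) \<longlonglongrightarrow> 0" for u v
      using that unfolding Q_eq by (rule H20_limit[OF \<Omega>])
  qed
  then show ?thesis using q by (simp only: arg_min simp_thms)
qed

end
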